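(* Let $X=N_{\mathbb R}/\Lambda$ be a real torus with integral structure of dimension $g$ with dual $\widehat X$, let $F_{E_X}:H^{\bullet,\bullet}(X)_{\mathbb Q}\to H^{\bullet,\bullet}(\widehat X)_{\mathbb Q}$ be the Fourier--Mukai transform on tropical cohomology, and for $p,q\ge0$ let $\alpha_{p,q}:H^{p,q}(X)\to H^{g-q,g-p}(\widehat X)$ be the composite $$H^{p,q}(X)\xrightarrow{\sim}H^{g-p,g-q}(X)^*\xrightarrow{\ \Psi_\Lambda^{\wedge (g-q)}\otimes\Psi_N^{\wedge(g-p)}\ }H^{g-q,g-p}(\widehat X),$$ where the first map is Poincaré duality and the second is induced by $c_1(\mathcal P_X)$. Then $$F_{E_X}|_{H^{p,q}(X)}=(-1)^{(2g-(p+q))(2g-(p+q)-1)/2}\,\alpha_{p,q}.$$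
   Context: For a lattice (finitely generated free abelian group) $M$ write $M_{\mathbb R}=M\otimes_{\mathbb Z}\mathbb R$, $M^*=\mathrm{Hom}(M,\mathbb Z)$. A real torus with integral structure of dimension $g$ is $X=N_{\mathbb R}/\Lambda$, where $N$ is a lattice of rank $g$ and $\Lambda\subset N_{\mathbb R}$ is a second lattice of full rank $g$. Its dual is $\widehat X=\Lambda^*_{\mathbb R}/N^*$ (integral structure given by $\Lambda^*$). Tropical cohomology: $H^{p,q}(X)=\bigwedge^q\Lambda^*\otimes\bigwedge^pN^*$, with cup product $(\alpha\otimes\omega)\smile(\beta\otimes\xi)=(\alpha\wedge\beta)\otimes(\omega\wedge\xi)$; hence $H^{p,q}(\widehat X)=\bigwedge^qN\otimes\bigwedge^p\Lambda$, which is identified (interchanging the tensor factors, without sign) with $\bigwedge^p\Lambda\otimes\bigwedge^qN$. Fix bases $\{\lambda_i\}_{i=1}^g$ of $\Lambda$ and $\{\eta_i\}_{i=1}^g$ of $N$ inducing the same orientation of $N_{\mathbb R}$, with dual bases $\{\lambda_i^*\},\{\eta_i^*\}$. Let $\delta:H^{\bullet,\bullet}(X)\to H^{g,g}(X)\cong\mathbb Z$ be projection to bidegree $(g,g)$ followed by $(\lambda_1^*\wedge\dots\wedge\lambda_g^* )\otimes(\eta_1^*\wedge\dots\wedge\eta_g^* )\mapsto1$. Poincaré duality $H^{p,q}(X)\xrightarrow{\sim}H^{g-p,g-q}(X)^*=\bigwedge^{g-q}\Lambda\otimes\bigwedge^{g-p}N$ sends $x$ to the functional $y\mapsto\delta(y\smile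 x)$. Künneth: $H^{\bullet,\bullet}(X\times\widehat X)=H^{\bullet,\bullet}(X)\otimes H^{\bullet,\bullet}(\widehat X)$, with product $(x\otimes y)\cdot(x'\otimes y')=(-1)^{|x||y'|}(x\smile x')\otimes(y\smile y')$, where $|\cdot|$ is the total degree $p+q$. For the projections $p_1,p_2$ of $X\times\widehat X$ to $X,\widehat X$: $p_1^*(x)=x\otimes1$, $p_{2*}(x\otimes y)=\delta(x)y$. The tropical Poincaré bundle $\mathcal P_X$ on $X\times\widehat X$ has first Chern class the bilinear form $E_X((n_1,\mu_1),(n_2,\mu_2))=-\mu_2(n_1)-\mu_1(n_2)$ on $N_{\mathbb R}\oplus\Lambda^*_{\mathbb R}$, i.e. $E_X=c_1(\mathcal P_X)=-\sum_i\eta_i^*\otimes\eta_i-\sum_i\lambda_i^*\otimes\lambda_i\in(N^*\otimes N)\oplus(\Lambda^*\otimes\Lambda)$, where $\eta_i^*\in H^{1,0}(X)$, $\eta_i\in H^{0,1}(\widehat X)$, $\lambda_i^*\in H^{0,1}(X)$, $\lambda_i\in H^{1,0}(\widehat X)$. The components of $c_1(\mathcal P_X)$ in $\Lambda^*\otimes\Lambda=\mathrm{End}(\Lambda)$ and $N^*\otimes N=\mathrm{End}(N)$ are $\Psi_\Lambda$ and $\Psi_N$. The Fourier--Mukai transform is $F_{E_X}(\alpha)=p_{2*}\big(e^{c_1(\mathcal P_X)}\cdot p_1^*\alpha\big)$ with $e^{c_1(\mathcal P_X)}=\sum_{k\ge0}\frac1{k!}c_1(\mathcal P_X)^k$. 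*)

theory Defs
  imports
    "Jordan_Normal_Form.Determinant"
    "HOL-Computational_Algebra.Group_Closure"
    "HOL-Library.Function_Algebras"
    "HOL-Library.Groups_Big_Fun"
    Complex_Main
begin

definition lattice_basis :: "nat \<Rightarrow> (nat \<Rightarrow> 'v::real_vector) \<Rightarrow> 'v set \<Rightarrow> bool" where
  "lattice_basis g b M \<longleftrightarrow>
     inj_on b {..<g} \<and> independent (b ` {..<g}) \<and>
     M = {\<Sum>i<g. real_of_int (c i) *\<^sub>R b i | c. True}"

definition is_lattice :: "nat \<Rightarrow> 'v::real_vector set \<Rightarrow> bool" where
  "is_lattice g M \<longleftrightarrow> (\<exists>b. lattice_basis g b M)"

text \<open>\<open>N\<^sub>\<real>\<close> is realised as the real span of \<open>N\<close> inside an ambient real vector space.\<close>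

definition real_torus :: "nat \<Rightarrow> 'v::real_vector set \<Rightarrow> 'v set \<Rightarrow> bool" where
  "real_torus g N \<Lambda> \<longleftrightarrow> is_lattice g N \<and> is_lattice g \<Lambda> \<and> \<Lambda> \<subseteq> span N"

definition same_orientation :: "nat \<Rightarrow> (nat \<Rightarrow> 'v::real_vector) \<Rightarrow> (nat \<Rightarrow> 'v) \<Rightarrow> bool" where
  "same_orientation g b b' \<longleftrightarrow>
     (\<exists>A \<in> carrier_mat g g. (\<forall>j<g. b' j = (\<Sum>i<g. A $$ (i, j) *\<^sub>R b i)) \<and> det A > 0)"

text \<open>\<open>M\<^sup>* = Hom(M, \<int>)\<close>; homomorphisms are extended by 0 outside \<open>M\<close>, so that they are
  determined by their values on \<open>M\<close>.\<close>

definition dual :: "'a::ab_group_add set \<Rightarrow> ('a \<Rightarrow> int) set" where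
  "dual M = {f. (\<forall>x\<in>M. \<forall>y\<in>M. f (x + y) = f x + f y) \<and> (\<forall>x. x \<notin> M \<longrightarrow> f x = 0)}"

definition dual_basis :: "nat \<Rightarrow> (nat \<Rightarrow> 'v::real_vector) \<Rightarrow> 'v set \<Rightarrow> nat \<Rightarrow> 'v \<Rightarrow> int" where
  "dual_basis g b M i = (THE f. f \<in> dual M \<and> (\<forall>j<g. f (b j) = (if j = i then 1 else 0)))"

text \<open>The canonical map \<open>M \<rightarrow> M\<^sup>*\<^sup>*\<close>.\<close>

definition bidual :: "'a::ab_group_add set \<Rightarrow> 'a \<Rightarrow> ('a \<Rightarrow> int) \<Rightarrow> int" where
  "bidual M v = (\<lambda>\<mu>. if \<mu> \<in> dual M then \<mu> v else 0)"

text \<open>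
  \<open>\<And>\<^sup>k M\<^sup>*\<close> is realised inside the functions on \<open>k\<close>-tuples of \<open>M\<close>: it is generated by the products
  \<open>\<mu>\<^sub>1 \<and> \<dots> \<and> \<mu>\<^sub>k\<close>, where the wedge product is the (integral) shuffle product, so that
  \<open>(\<mu>\<^sub>1 \<and> \<dots> \<and> \<mu>\<^sub>k)(v\<^sub>1, \<dots>, v\<^sub>k) = det (\<mu>\<^sub>i(v\<^sub>j))\<close>. The canonical map from the exterior power is
  injective because \<open>M\<close> is free of finite rank. A function on lists of arbitrary length carries
  all degrees at once, its degree \<open>k\<close> part being its restriction to lists of length \<open>k\<close>.
\<close>

type_synonym 'a form = "'a list \<Rightarrow> rat"

definition one_form :: "('a \<Rightarrow> int) \<Rightarrow> 'a form" where
  "one_form \<mu> = (\<lambda>vs. if length vs = 1 then of_int (\<mu> (hd vs)) else 0)"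

definition unit_form :: "'a form" where
  "unit_form = (\<lambda>vs. if vs = [] then 1 else 0)"

text \<open>The sign of the permutation of \<open>{..<n}\<close> listing \<open>S\<close> before its complement, both increasingly.\<close>

definition shuffle_sign :: "nat \<Rightarrow> nat set \<Rightarrow> rat" where
  "shuffle_sign n S = (-1) ^ card {(i, j). i \<in> S \<and> j \<in> {..<n} - S \<and> j < i}"

definition wedge :: "'a form \<Rightarrow> 'a form \<Rightarrow> 'a form" where
  "wedge \<alpha> \<beta> = (\<lambda>vs. \<Sum>S\<in>Pow {..<length vs}.
     shuffle_sign (length vs) S * \<alpha> (nths vs S) * \<beta> (nths vs (- S)))"

definition wedge_list :: "('a \<Rightarrow> int) list \<Rightarrow> 'a form" where
  "wedge_list \<mu>s = foldr (\<lambda>\<mu>. wedge (one_form \<mu>)) \<mu>s unit_form"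

text \<open>Elements of \<open>\<And>A\<^sup>* \<otimes> \<And>B\<^sup>*\<close> are functions of a list in \<open>A\<close> and a list in \<open>B\<close>.\<close>

type_synonym ('a, 'b) biform = "'a list \<Rightarrow> 'b list \<Rightarrow> rat"

definition tens :: "'a form \<Rightarrow> 'b form \<Rightarrow> ('a, 'b) biform" (infixr "\<otimes>\<^sub>f" 75) where
  "\<alpha> \<otimes>\<^sub>f \<omega> = (\<lambda>as bs. \<alpha> as * \<omega> bs)"

text \<open>The group \<open>\<And>\<^sup>q A\<^sup>* \<otimes> \<And>\<^sup>p B\<^sup>*\<close>.\<close>

definition ext_tensor ::
  "'a::ab_group_add set \<Rightarrow> 'b::ab_group_add set \<Rightarrow> nat \<Rightarrow> nat \<Rightarrow> ('a, 'b) biform set" where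
  "ext_tensor A B q p = group_closure
     {wedge_list \<mu>s \<otimes>\<^sub>f wedge_list \<nu>s | \<mu>s \<nu>s.
        \<mu>s \<in> lists (dual A) \<and> length \<mu>s = q \<and> \<nu>s \<in> lists (dual B) \<and> length \<nu>s = p}"

text \<open>
  \<open>H\<^sup>p\<^sup>,\<^sup>q(X) = \<And>\<^sup>q\<Lambda>\<^sup>* \<otimes> \<And>\<^sup>pN\<^sup>*\<close> for \<open>X = N\<^sub>\<real>/\<Lambda>\<close>. Values are taken in \<open>\<rat>\<close>, so that integral and rational
  classes live in the same type. The dual torus has integral structure \<open>\<Lambda>\<^sup>*\<close> and period lattice
  \<open>N\<^sup>*\<close>, so that \<open>H\<^sup>p\<^sup>,\<^sup>q\<close> of it is \<open>trop_coh (dual \<Lambda>) (dual N) p q\<close>: functions of \<open>q\<close> elements of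
  \<open>N\<^sup>*\<close> and \<open>p\<close> elements of \<open>\<Lambda>\<^sup>*\<close>.
\<close>

definition trop_coh ::
  "'b::ab_group_add set \<Rightarrow> 'a::ab_group_add set \<Rightarrow> nat \<Rightarrow> nat \<Rightarrow> ('a, 'b) biform set" where
  "trop_coh N \<Lambda> p q = ext_tensor \<Lambda> N q p"

definition unit_class :: "('a, 'b) biform" where
  "unit_class = unit_form \<otimes>\<^sub>f unit_form"

text \<open>The bilinear extension of
  \<open>(\<alpha> \<otimes> \<omega>) \<smile> (\<beta> \<otimes> \<xi>) = (\<alpha> \<and> \<beta>) \<otimes> (\<omega> \<and> \<xi>)\<close>, see \<open>cup_tens\<close>.\<close>

definition cup :: "('a, 'b) biform \<Rightarrow> ('a, 'b) biform \<Rightarrow> ('a, 'b) biform" (infixl "\<smile>" 70) where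
  "x \<smile> y = (\<lambda>as bs. \<Sum>S\<in>Pow {..<length as}. \<Sum>T\<in>Pow {..<length bs}.
     shuffle_sign (length as) S * shuffle_sign (length bs) T *
     x (nths as S) (nths bs T) * y (nths as (- S)) (nths bs (- T)))"

lemma cup_tens: "(\<alpha> \<otimes>\<^sub>f \<omega>) \<smile> (\<beta> \<otimes>\<^sub>f \<xi>) = wedge \<alpha> \<beta> \<otimes>\<^sub>f wedge \<omega> \<xi>"
  by (simp add: fun_eq_iff cup_def tens_def wedge_def sum_product mult_ac)

definition bideg_proj :: "nat \<Rightarrow> nat \<Rightarrow> ('a, 'b) biform \<Rightarrow> ('a, 'b) biform" where
  "bideg_proj p q x = (\<lambda>as bs. if length as = q \<and> length bs = p then x as bs else 0)"

definition top_class ::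
  "nat \<Rightarrow> 'v::real_vector set \<Rightarrow> 'v set \<Rightarrow> (nat \<Rightarrow> 'v) \<Rightarrow> (nat \<Rightarrow> 'v) \<Rightarrow> ('v, 'v) biform" where
  "top_class g N \<Lambda> eta lam =
     wedge_list (map (dual_basis g lam \<Lambda>) [0..<g]) \<otimes>\<^sub>f wedge_list (map (dual_basis g eta N) [0..<g])"

definition delta ::
  "nat \<Rightarrow> 'v::real_vector set \<Rightarrow> 'v set \<Rightarrow> (nat \<Rightarrow> 'v) \<Rightarrow> (nat \<Rightarrow> 'v) \<Rightarrow> ('v, 'v) biform \<Rightarrow> rat" where
  "delta g N \<Lambda> eta lam x =
     (THE c. bideg_proj g g x = (\<lambda>as bs. c * top_class g N \<Lambda> eta lam as bs))"

text \<open>An element of \<open>H(X) \<otimes> H(Y)\<close>, where \<open>Y\<close> is the dual torus of \<open>X\<close>, is a function of four lists, with entries in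
  \<open>\<Lambda>\<close>, \<open>N\<close>, \<open>N\<^sup>*\<close>, \<open>\<Lambda>\<^sup>*\<close> respectively.\<close>

type_synonym ('a, 'b, 'c, 'd) quadform = "'a list \<Rightarrow> 'b list \<Rightarrow> 'c list \<Rightarrow> 'd list \<Rightarrow> rat"

definition ktens :: "('a, 'b) biform \<Rightarrow> ('c, 'd) biform \<Rightarrow> ('a, 'b, 'c, 'd) quadform"
    (infixr "\<otimes>\<^sub>K" 65) where
  "x \<otimes>\<^sub>K y = (\<lambda>as bs cs ds. x as bs * y cs ds)"

text \<open>The bilinear extension of
  \<open>(x \<otimes> y) \<cdot> (x' \<otimes> y') = (-1)^(|x||y'|) (x \<smile> x') \<otimes> (y \<smile> y')\<close>, see \<open>kprod_ktens\<close>.\<close>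

definition kprod :: "('a, 'b, 'c, 'd) quadform \<Rightarrow> ('a, 'b, 'c, 'd) quadform \<Rightarrow>
    ('a, 'b, 'c, 'd) quadform" where
  "kprod Z W = (\<lambda>as bs cs ds.
     \<Sum>S\<in>Pow {..<length as}. \<Sum>T\<in>Pow {..<length bs}.
     \<Sum>U\<in>Pow {..<length cs}. \<Sum>V\<in>Pow {..<length ds}.
       shuffle_sign (length as) S * shuffle_sign (length bs) T *
       shuffle_sign (length cs) U * shuffle_sign (length ds) V *
       (-1) ^ ((length (nths as S) + length (nths bs T)) *
               (length (nths cs (- U)) + length (nths ds (- V)))) *
       Z (nths as S) (nths bs T) (nths cs U) (nths ds V) *
       W (nths as (- S)) (nths bs (- T)) (nths cs (- U)) (nths ds (- V)))"

lemma kprod_ktens: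
  assumes x: "\<And>as bs. length as + length bs \<noteq> m \<Longrightarrow> x as bs = 0"
    and y': "\<And>cs ds. length cs + length ds \<noteq> n \<Longrightarrow> y' cs ds = 0"
  shows "kprod (x \<otimes>\<^sub>K y) (x' \<otimes>\<^sub>K y') = (\<lambda>as bs cs ds. (-1) ^ (m * n) * ((x \<smile> x') \<otimes>\<^sub>K (y \<smile> y')) as bs cs ds)"
proof (intro ext)
  fix as :: "'a list" and bs :: "'b list" and cs :: "'c list" and ds :: "'d list"
  let ?s = "shuffle_sign (length as)" and ?t = "shuffle_sign (length bs)"
  let ?u = "shuffle_sign (length cs)" and ?v = "shuffle_sign (length ds)"
  have sgn: "(-1) ^ ((length a + length b) * (length c + length d)) * (x a b * y' c d)
      = (-1) ^ (m * n) * (x a b * y' c d)" for a :: "'a list" and b :: "'b list"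
      and c :: "'c list" and d :: "'d list"
    using x[of a b] y'[of c d] by fastforce
  have "kprod (x \<otimes>\<^sub>K y) (x' \<otimes>\<^sub>K y') as bs cs ds =
     (\<Sum>S\<in>Pow {..<length as}. \<Sum>T\<in>Pow {..<length bs}.
      \<Sum>U\<in>Pow {..<length cs}. \<Sum>V\<in>Pow {..<length ds}.
       ?s S * ?t T * ?u U * ?v V * y (nths cs U) (nths ds V) * x' (nths as (- S)) (nths bs (- T)) *
       ((-1) ^ ((length (nths as S) + length (nths bs T)) *
               (length (nths cs (- U)) + length (nths ds (- V)))) *
        (x (nths as S) (nths bs T) * y' (nths cs (- U)) (nths ds (- V)))))"
    unfolding kprod_def ktens_def by (simp only: mult_ac)
  also have "\<dots> = (-1) ^ (m * n) * ((x \<smile> x') as bs * (y \<smile> y') cs ds)"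
    unfolding sgn cup_def sum_distrib_right unfolding sum_distrib_left by (simp only: mult_ac)
  finally show "kprod (x \<otimes>\<^sub>K y) (x' \<otimes>\<^sub>K y') as bs cs ds =
      (-1) ^ (m * n) * ((x \<smile> x') \<otimes>\<^sub>K (y \<smile> y')) as bs cs ds"
    by (simp add: ktens_def)
qed

primrec kpower :: "('a, 'b, 'c, 'd) quadform \<Rightarrow> nat \<Rightarrow> ('a, 'b, 'c, 'd) quadform" where
  "kpower Z 0 = unit_class \<otimes>\<^sub>K unit_class"
| "kpower Z (Suc k) = kprod Z (kpower Z k)"

text \<open>For \<open>Z\<close> without component of degree 0, as is the case for a Chern class, only finitely many
  powers contribute to the value on given arguments.\<close>

definition kexp :: "('a, 'b, 'c, 'd) quadform \<Rightarrow> ('a, 'b, 'c, 'd) quadform" where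
  "kexp Z = (\<lambda>as bs cs ds. Sum_any (\<lambda>k. 1 / fact k * kpower Z k as bs cs ds))"

definition pullback1 :: "('a, 'b) biform \<Rightarrow> ('a, 'b, 'c, 'd) quadform" where
  "pullback1 x = x \<otimes>\<^sub>K unit_class"

text \<open>The linear extension of \<open>x \<otimes> y \<mapsto> \<delta>(x) y\<close>.\<close>

definition pushforward2 ::
  "nat \<Rightarrow> 'v::real_vector set \<Rightarrow> 'v set \<Rightarrow> (nat \<Rightarrow> 'v) \<Rightarrow> (nat \<Rightarrow> 'v) \<Rightarrow>
   ('v, 'v, 'c, 'd) quadform \<Rightarrow> ('c, 'd) biform" where
  "pushforward2 g N \<Lambda> eta lam Z = (\<lambda>cs ds. delta g N \<Lambda> eta lam (\<lambda>as bs. Z as bs cs ds))"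

definition c1_poincare ::
  "nat \<Rightarrow> 'v::real_vector set \<Rightarrow> 'v set \<Rightarrow> (nat \<Rightarrow> 'v) \<Rightarrow> (nat \<Rightarrow> 'v) \<Rightarrow>
   ('v, 'v, 'v \<Rightarrow> int, 'v \<Rightarrow> int) quadform" where
  "c1_poincare g N \<Lambda> eta lam =
     - (\<Sum>i<g. (unit_form \<otimes>\<^sub>f one_form (dual_basis g eta N i)) \<otimes>\<^sub>K
               (one_form (bidual N (eta i)) \<otimes>\<^sub>f unit_form))
     - (\<Sum>i<g. (one_form (dual_basis g lam \<Lambda> i) \<otimes>\<^sub>f unit_form) \<otimes>\<^sub>K
               (unit_form \<otimes>\<^sub>f one_form (bidual \<Lambda> (lam i))))"

definition fourier_mukai ::
  "nat \<Rightarrow> 'v::real_vector set \<Rightarrow> 'v set \<Rightarrow> (nat \<Rightarrow> 'v) \<Rightarrow> (nat \<Rightarrow> 'v) \<Rightarrow>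
   ('v, 'v) biform \<Rightarrow> ('v \<Rightarrow> int, 'v \<Rightarrow> int) biform" where
  "fourier_mukai g N \<Lambda> eta lam x =
     pushforward2 g N \<Lambda> eta lam (kprod (kexp (c1_poincare g N \<Lambda> eta lam)) (pullback1 x))"

text \<open>The components of a class in \<open>\<Lambda>\<^sup>* \<otimes> \<Lambda> = End \<Lambda>\<close> and \<open>N\<^sup>* \<otimes> N = End N\<close>: the tensor \<open>\<mu> \<otimes> u\<close> is the
  endomorphism \<open>v \<mapsto> \<mu>(v) u\<close>, and it is the biform \<open>(v, \<mu>') \<mapsto> \<mu>(v) \<mu>'(u)\<close>.\<close>

definition Psi_Lambda ::
  "'v::real_vector set \<Rightarrow> ('v, 'v, 'v \<Rightarrow> int, 'v \<Rightarrow> int) quadform \<Rightarrow> 'v \<Rightarrow> 'v" where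
  "Psi_Lambda \<Lambda> Z v = (THE u. u \<in> \<Lambda> \<and> (\<forall>\<mu> \<in> dual \<Lambda>. of_int (\<mu> u) = Z [v] [] [] [\<mu>]))"

definition Psi_N ::
  "'v::real_vector set \<Rightarrow> ('v, 'v, 'v \<Rightarrow> int, 'v \<Rightarrow> int) quadform \<Rightarrow> 'v \<Rightarrow> 'v" where
  "Psi_N N Z v = (THE u. u \<in> N \<and> (\<forall>\<nu> \<in> dual N. of_int (\<nu> u) = Z [] [v] [\<nu>] []))"

text \<open>The identification of functionals on \<open>\<And>\<^sup>q A\<^sup>* \<otimes> \<And>\<^sup>p B\<^sup>*\<close> with elements of
  \<open>\<And>\<^sup>q A \<otimes> \<And>\<^sup>p B\<close> (in which \<open>A = A\<^sup>*\<^sup>*\<close>, \<open>B = B\<^sup>*\<^sup>*\<close>), by the pairing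
  \<open>\<langle>\<mu>\<^sub>1 \<and> \<dots> \<and> \<mu>\<^sub>k, v\<^sub>1 \<and> \<dots> \<and> v\<^sub>k\<rangle> = det (\<mu>\<^sub>i(v\<^sub>j))\<close>, which is the value of the form
  \<open>v\<^sub>1 \<and> \<dots> \<and> v\<^sub>k\<close> on \<open>(\<mu>\<^sub>1, \<dots>, \<mu>\<^sub>k)\<close>.\<close>

definition element_of_functional ::
  "'a::ab_group_add set \<Rightarrow> 'b::ab_group_add set \<Rightarrow> nat \<Rightarrow> nat \<Rightarrow>
   (('a, 'b) biform \<Rightarrow> rat) \<Rightarrow> ('a \<Rightarrow> int, 'b \<Rightarrow> int) biform" where
  "element_of_functional A B q p \<phi> =
     (THE z. z \<in> ext_tensor (dual A) (dual B) q p \<and>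
        (\<forall>\<mu>s \<in> lists (dual A). \<forall>\<nu>s \<in> lists (dual B). length \<mu>s = q \<longrightarrow> length \<nu>s = p \<longrightarrow>
           z \<mu>s \<nu>s = \<phi> (wedge_list \<mu>s \<otimes>\<^sub>f wedge_list \<nu>s)))"

definition poincare_duality ::
  "nat \<Rightarrow> 'v::real_vector set \<Rightarrow> 'v set \<Rightarrow> (nat \<Rightarrow> 'v) \<Rightarrow> (nat \<Rightarrow> 'v) \<Rightarrow> nat \<Rightarrow> nat \<Rightarrow>
   ('v, 'v) biform \<Rightarrow> ('v \<Rightarrow> int, 'v \<Rightarrow> int) biform" where
  "poincare_duality g N \<Lambda> eta lam p q x =
     element_of_functional \<Lambda> N (g - q) (g - p) (\<lambda>y. delta g N \<Lambda> eta lam (y \<smile> x))"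

text \<open>The map \<open>\<And>f \<otimes> \<And>h\<close> on \<open>\<And>A \<otimes> \<And>B\<close> induced by \<open>f \<in> End A\<close>, \<open>h \<in> End B\<close>: as a form on \<open>A\<^sup>*\<close>,
  \<open>f v\<^sub>1 \<and> \<dots> \<and> f v\<^sub>k\<close> is \<open>v\<^sub>1 \<and> \<dots> \<and> v\<^sub>k\<close> precomposed with the transpose \<open>\<mu> \<mapsto> \<mu> \<circ> f\<close>.\<close>

definition transpose_map :: "'a set \<Rightarrow> ('a \<Rightarrow> 'a) \<Rightarrow> ('a \<Rightarrow> int) \<Rightarrow> ('a \<Rightarrow> int)" where
  "transpose_map A f \<mu> = (\<lambda>v. if v \<in> A then \<mu> (f v) else 0)"

definition induced_map ::
  "'a::ab_group_add set \<Rightarrow> 'b::ab_group_add set \<Rightarrow> ('a \<Rightarrow> 'a) \<Rightarrow> ('b \<Rightarrow> 'b) \<Rightarrow>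
   ('a \<Rightarrow> int, 'b \<Rightarrow> int) biform \<Rightarrow> ('a \<Rightarrow> int, 'b \<Rightarrow> int) biform" where
  "induced_map A B f h z = (\<lambda>\<mu>s \<nu>s.
     if \<mu>s \<in> lists (dual A) \<and> \<nu>s \<in> lists (dual B)
     then z (map (transpose_map A f) \<mu>s) (map (transpose_map B h) \<nu>s) else 0)"

definition swap_factors :: "('a, 'b) biform \<Rightarrow> ('b, 'a) biform" where
  "swap_factors z = (\<lambda>bs as. z as bs)"

text \<open>For \<open>p > g\<close> or \<open>q > g\<close> the source \<open>H\<^sup>p\<^sup>,\<^sup>q(X)\<close> is zero, and the truncation in \<open>g - p\<close>, \<open>g - q\<close> is
  harmless.\<close>

definition alpha_map ::
  "nat \<Rightarrow> 'v::real_vector set \<Rightarrow> 'v set \<Rightarrow> (nat \<Rightarrow> 'v) \<Rightarrow> (nat \<Rightarrow> 'v) \<Rightarrow> nat \<Rightarrow> nat \<Rightarrow>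
   ('v, 'v) biform \<Rightarrow> ('v \<Rightarrow> int, 'v \<Rightarrow> int) biform" where
  "alpha_map g N \<Lambda> eta lam p q x =
     swap_factors (induced_map \<Lambda> N
       (Psi_Lambda \<Lambda> (c1_poincare g N \<Lambda> eta lam)) (Psi_N N (c1_poincare g N \<Lambda> eta lam))
       (poincare_duality g N \<Lambda> eta lam p q x))"

end

theory Submission
  imports Defs
begin

text \<open>
  By duality of bases \<open>c\<^sub>1(P)\<close> is, up to sign, the evaluation pairing of \<open>\<Lambda>\<close> with \<open>\<Lambda>\<^sup>*\<close> plus that of
  \<open>N\<close> with \<open>N\<^sup>*\<close>. Laplace expansion shows that the value of \<open>exp c\<^sub>1(P)\<close> on tuples of vectors and
  functionals is the product of the two determinants of all pairings, with sign \<open>(-1)^(m(m-1)/2)\<close>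
  in total degree \<open>m\<close>. Regarded as forms in the vectors these determinants are wedge products of
  the negated functionals, so the transform of \<open>x\<close> takes functionals \<open>\<nu>\<^sub>i\<close> of \<open>N\<close> and \<open>\<mu>\<^sub>j\<close> of \<open>\<Lambda>\<close> to
  \<open>\<delta>\<close> of (the wedge of the \<open>-\<mu>\<^sub>j\<close>) \<open>\<otimes>\<close> (the wedge of the \<open>-\<nu>\<^sub>i\<close>) \<open>\<smile> x\<close>. This is the Poincare dual of
  \<open>x\<close> precomposed with the transposes of \<open>\<Psi>\<^sub>\<Lambda> = -id\<close> and \<open>\<Psi>\<^sub>N = -id\<close>.
\<close>

subsection \<open>Subsets and shuffles\<close>

text \<open>A subset of \<open>{..<Suc n}\<close> either contains 0 or not, and in both cases it is
  determined by a shifted subset of \<open>{..<n}\<close>. This recursion lets shuffle sums be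
  treated by induction on the argument list.\<close>

lemma sum_Pow_lessThan_Suc:
  fixes h :: "nat set \<Rightarrow> 'a::comm_monoid_add"
  shows "(\<Sum>S\<in>Pow {..<Suc n}. h S) =
    (\<Sum>S\<in>Pow {..<n}. h (insert 0 (Suc ` S))) + (\<Sum>S\<in>Pow {..<n}. h (Suc ` S))"
proof -
  have eq: "Pow {..<Suc n} = insert 0 ` (image Suc ` Pow {..<n}) \<union> image Suc ` Pow {..<n}"
    unfolding lessThan_Suc_eq_insert_0 Pow_insert by (simp add: image_Pow_surj Un_commute)
  have inj: "inj_on (image Suc) (Pow {..<n})"
    by (rule inj_onI) (simp add: inj_image_eq_iff)
  have inj0: "inj_on (insert 0) (image Suc ` Pow {..<n})"
    by (rule inj_onI) (metis (no_types, lifting) imageE insert_ident nat.distinct(1))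
  have "insert 0 ` (image Suc ` Pow {..<n}) \<inter> image Suc ` Pow {..<n} = {}"
    by fastforce
  then show ?thesis
    unfolding eq using inj inj0 by (subst sum.union_disjoint) (auto simp: sum.reindex)
qed

lemma card_inversions_image_Suc:
  "card {(i, j). i \<in> Suc ` S \<and> j \<in> Suc ` T \<and> j < i} = card {(i, j). i \<in> S \<and> j \<in> T \<and> j < i}"
proof -
  have "{(i, j). i \<in> Suc ` S \<and> j \<in> Suc ` T \<and> j < i} = map_prod Suc Suc ` {(i, j). i \<in> S \<and> j \<in> T \<and> j < i}"
    by (auto simp: image_iff)
  moreover have "inj (map_prod Suc Suc)"
    by (simp add: prod.inj_map)
  ultimately show ?thesis
    by (simp add: card_image inj_on_subset)
qed

lemma shuffle_sign_insert_0:
  "shuffle_sign (Suc n) (insert 0 (Suc ` S)) = shuffle_sign n S"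
proof -
  have "{(i, j). i \<in> insert 0 (Suc ` S) \<and> j \<in> {..<Suc n} - insert 0 (Suc ` S) \<and> j < i}
      = {(i, j). i \<in> Suc ` S \<and> j \<in> Suc ` ({..<n} - S) \<and> j < i}"
    unfolding lessThan_Suc_eq_insert_0 by auto
  then show ?thesis
    unfolding shuffle_sign_def by (simp only: card_inversions_image_Suc)
qed

text \<open>Here 0 belongs to the complement and lies below every element of the shifted set, so it
  adds one inversion for each of the \<open>card S\<close> elements.\<close>

lemma shuffle_sign_image_Suc:
  assumes "finite S"
  shows "shuffle_sign (Suc n) (Suc ` S) = (-1) ^ card S * shuffle_sign n S"
proof -
  let ?I = "{(i, j). i \<in> Suc ` S \<and> j \<in> Suc ` ({..<n} - S) \<and> j < i}"
  have eq: "{(i, j). i \<in> Suc ` S \<and> j \<in> {..<Suc n} - Suc ` S \<and> j < i} = Suc ` S \<times> {0} \<union> ?I"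
    unfolding lessThan_Suc_eq_insert_0 by auto
  have "finite ?I"
    by (rule finite_subset[of _ "Suc ` S \<times> Suc ` {..<n}"]) (use assms in auto)
  then have "card (Suc ` S \<times> {0} \<union> ?I) = card S + card {(i, j). i \<in> S \<and> j \<in> {..<n} - S \<and> j < i}"
    by (subst card_Un_disjoint)
      (use assms in \<open>auto simp: card_cartesian_product card_image card_inversions_image_Suc simp del: Diff_iff\<close>)
  then show ?thesis
    unfolding shuffle_sign_def eq by (simp add: power_add)
qed

lemma shuffle_sign_empty: "shuffle_sign n {} = 1"
  by (simp add: shuffle_sign_def)

lemma shuffle_sign_full: "shuffle_sign n {..<n} = 1"
  by (simp add: shuffle_sign_def)

lemma shuffle_sign_singleton:
  assumes "i < n"
  shows "shuffle_sign n {i} = (-1) ^ i"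
proof -
  have "{(k, j). k \<in> {i} \<and> j \<in> {..<n} - {i} \<and> j < k} = {i} \<times> {..<i}"
    using assms by auto
  then show ?thesis
    by (simp add: shuffle_sign_def card_cartesian_product)
qed

section \<open>Sublists selected by index sets and collapsing of subset sums\<close>

lemma length_nths_subset: "S \<subseteq> {..<length xs} \<Longrightarrow> length (nths xs S) = card S"
  unfolding length_nths by (rule arg_cong[of _ _ card]) auto

lemma length_nths_Compl:
  assumes "S \<subseteq> {..<length xs}"
  shows "length (nths xs (- S)) = length xs - card S"
proof -
  have "{i. i < length xs \<and> i \<in> - S} = {..<length xs} - S"
    by auto
  then show ?thesis
    unfolding length_nths using assms by (simp add: card_Diff_subset finite_subset)
qed

lemma nths_Compl_singleton: "nths xs (- {i}) = take i xs @ drop (Suc i) xs"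
proof (induction xs arbitrary: i)
  case (Cons x xs)
  then show ?case
  proof (cases i)
    case 0
    then have "{j. Suc j \<in> - {i}} = UNIV"
      by auto
    with 0 show ?thesis
      by (simp add: nths_Cons nths_all)
  next
    case (Suc k)
    then have "{j. Suc j \<in> - {i}} = - {k}"
      by auto
    with Suc Cons show ?thesis
      by (simp add: nths_Cons)
  qed
qed simp

lemma nths_singleton_nth: "i < length xs \<Longrightarrow> nths xs {i} = [xs ! i]"
proof (induction xs arbitrary: i)
  case (Cons x xs)
  show ?case
  proof (cases i)
    case (Suc k)
    then have "{j. Suc j \<in> {i}} = {k}"
      by auto
    with Suc Cons show ?thesis
      by (simp add: nths_Cons)
  qed (simp add: nths_Cons)
qed simp

text \<open>This and its two companions evaluate shuffle sums in which one factor is homogeneous of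
  degree 0 or 1: only the empty, the full or the one-element index sets survive.\<close>

lemma sum_Pow_empty:
  fixes h :: "nat set \<Rightarrow> 'a::comm_monoid_add"
  assumes "\<And>S. S \<subseteq> {..<n} \<Longrightarrow> S \<noteq> {} \<Longrightarrow> h S = 0"
  shows "(\<Sum>S\<in>Pow {..<n}. h S) = h {}"
proof -
  have "(\<Sum>S\<in>Pow {..<n}. h S) = (\<Sum>S\<in>{{}}. h S)"
    by (rule sum.mono_neutral_right) (use assms in auto)
  then show ?thesis by simp
qed

lemma sum_Pow_full:
  fixes h :: "nat set \<Rightarrow> 'a::comm_monoid_add"
  assumes "\<And>S. S \<subseteq> {..<n} \<Longrightarrow> S \<noteq> {..<n} \<Longrightarrow> h S = 0"
  shows "(\<Sum>S\<in>Pow {..<n}. h S) = h {..<n}"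
proof -
  have "(\<Sum>S\<in>Pow {..<n}. h S) = (\<Sum>S\<in>{{..<n}}. h S)"
    by (rule sum.mono_neutral_right) (use assms in auto)
  then show ?thesis by simp
qed

lemma sum_Pow_singletons:
  fixes h :: "nat set \<Rightarrow> 'a::comm_monoid_add"
  assumes "\<And>S. S \<subseteq> {..<n} \<Longrightarrow> card S \<noteq> 1 \<Longrightarrow> h S = 0"
  shows "(\<Sum>S\<in>Pow {..<n}. h S) = (\<Sum>i<n. h {i})"
proof -
  have "(\<Sum>S\<in>Pow {..<n}. h S) = (\<Sum>S\<in>(\<lambda>i. {i}) ` {..<n}. h S)"
    by (rule sum.mono_neutral_right) (use assms in \<open>auto simp: card_1_singleton_iff\<close>)
  also have "\<dots> = (\<Sum>i<n. h {i})"
    by (subst sum.reindex) (auto simp: inj_on_def)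
  finally show ?thesis .
qed

subsection \<open>The shuffle product\<close>

text \<open>Splitting the shuffles according to the position of the first argument makes the
  contraction \<open>\<alpha> \<mapsto> (\<lambda>vs. \<alpha> (v # vs))\<close> a graded derivation; associativity then follows by induction
  on the arguments.\<close>

definition parity_twist :: "'a form \<Rightarrow> 'a form" where
  "parity_twist \<alpha> = (\<lambda>vs. (-1) ^ length vs * \<alpha> vs)"

lemma wedge_Nil: "wedge \<alpha> \<beta> [] = \<alpha> [] * \<beta> []"
  by (simp add: wedge_def shuffle_sign_def)

lemma wedge_Cons:
  "wedge \<alpha> \<beta> (v # vs) =
    wedge (\<lambda>ws. \<alpha> (v # ws)) \<beta> vs + wedge (parity_twist \<alpha>) (\<lambda>ws. \<beta> (v # ws)) vs"
proof -
  have Suc_mem: "{j. Suc j \<in> insert 0 (Suc ` S)} = S" "{j. Suc j \<in> Suc ` S} = S"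
    "{j. Suc j \<in> - insert 0 (Suc ` S)} = - S" "{j. Suc j \<in> - Suc ` S} = - S" for S
    by auto
  show ?thesis
    unfolding wedge_def length_Cons sum_Pow_lessThan_Suc
    \<comment> \<open>When \<open>v\<close> goes to the second factor, the extra sign
      \<open>(-1) ^ card S\<close> is the parity of the number of arguments handed to the first one,
      which is what \<open>parity_twist\<close> records.\<close>
    by (intro arg_cong2[of _ _ _ _ "(+)"] sum.cong refl)
      (auto simp: nths_Cons Suc_mem[simplified] shuffle_sign_insert_0 shuffle_sign_image_Suc parity_twist_def
        length_nths_subset finite_subset)
qed

lemma wedge_add_left: "wedge (\<lambda>vs. \<alpha> vs + \<alpha>' vs) \<beta> vs = wedge \<alpha> \<beta> vs + wedge \<alpha>' \<beta> vs"
  by (simp add: wedge_def sum.distrib algebra_simps)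

lemma wedge_add_right: "wedge \<alpha> (\<lambda>vs. \<beta> vs + \<beta>' vs) vs = wedge \<alpha> \<beta> vs + wedge \<alpha> \<beta>' vs"
  by (simp add: wedge_def sum.distrib algebra_simps)

text \<open>Complementary sublists have lengths adding up to the whole, so the twist is
  multiplicative. Associativity needs this for the term in which the new argument reaches the third
  factor.\<close>

lemma parity_twist_wedge: "parity_twist (wedge \<alpha> \<beta>) = wedge (parity_twist \<alpha>) (parity_twist \<beta>)"
proof
  fix vs :: "'a list"
  have "(-1) ^ length vs = ((-1) ^ length (nths vs S) * (-1) ^ length (nths vs (- S)) :: rat)"
    if "S \<in> Pow {..<length vs}" for S
  proof -
    have "card S \<le> length vs"
      using that card_mono[of "{..<length vs}" S] by simp
    then show ?thesis
      using that by (simp add: length_nths_subset length_nths_Compl flip: power_add)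
  qed
  then show "parity_twist (wedge \<alpha> \<beta>) vs = wedge (parity_twist \<alpha>) (parity_twist \<beta>) vs"
    unfolding parity_twist_def wedge_def sum_distrib_left by (intro sum.cong) auto
qed

lemma wedge_assoc: "wedge (wedge \<alpha> \<beta>) \<gamma> = wedge \<alpha> (wedge \<beta> \<gamma>)"
proof
  fix vs
  show "wedge (wedge \<alpha> \<beta>) \<gamma> vs = wedge \<alpha> (wedge \<beta> \<gamma>) vs"
  proof (induction vs arbitrary: \<alpha> \<beta> \<gamma>)
    case (Cons v vs)
    then show ?case
      by (simp add: wedge_Cons wedge_add_left wedge_add_right parity_twist_wedge)
  qed (simp add: wedge_Nil)
qed

lemma wedge_unit_form: "wedge unit_form \<alpha> = \<alpha>"
proof
  fix vs :: "'a list"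
  have "wedge unit_form \<alpha> vs = shuffle_sign (length vs) {} * unit_form (nths vs {}) * \<alpha> (nths vs (- {}))"
    unfolding wedge_def
    by (rule sum_Pow_empty)
      (auto simp: unit_form_def length_nths_subset finite_subset simp flip: length_0_conv)
  then show "wedge unit_form \<alpha> vs = \<alpha> vs"
    by (simp add: shuffle_sign_empty unit_form_def nths_all)
qed

lemma wedge_list_append: "wedge_list (\<mu>s @ \<nu>s) = wedge (wedge_list \<mu>s) (wedge_list \<nu>s)"
  by (induction \<mu>s) (simp_all add: wedge_list_def wedge_unit_form wedge_assoc)

text \<open>Only one-element shuffles survive, with sign \<open>(-1) ^ i\<close>. The result is a
  cofactor expansion and links wedge products to determinants.\<close>

lemma wedge_one_form:
  "wedge (one_form \<mu>) \<beta> vs = (\<Sum>i<length vs. (-1) ^ i * of_int (\<mu> (vs ! i)) * \<beta> (nths vs (- {i})))"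
proof -
  have "wedge (one_form \<mu>) \<beta> vs = (\<Sum>i<length vs.
      shuffle_sign (length vs) {i} * one_form \<mu> (nths vs {i}) * \<beta> (nths vs (- {i})))"
    unfolding wedge_def by (rule sum_Pow_singletons) (simp add: one_form_def length_nths_subset)
  then show ?thesis
    by (simp add: shuffle_sign_singleton one_form_def nths_singleton_nth)
qed

subsection \<open>Determinants of pairings\<close>

text \<open>The value 0 on lists of different lengths encodes the grading, so that identities can be
  stated for all degrees at once.\<close>

definition pairing_det :: "('a \<Rightarrow> 'b \<Rightarrow> rat) \<Rightarrow> 'a list \<Rightarrow> 'b list \<Rightarrow> rat" where
  "pairing_det P as bs = (if length as = length bs
     then det (mat (length as) (length as) (\<lambda>(i, j). P (as ! i) (bs ! j))) else 0)"

lemma pairing_det_Nil: "pairing_det P [] [] = 1"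
  by (simp add: pairing_det_def det_def)

lemma nth_nths_Compl_singleton:
  "i < length xs \<Longrightarrow> k < length xs - 1 \<Longrightarrow> nths xs (- {i}) ! k = xs ! (if k < i then k else Suc k)"
  by (auto simp: nths_Compl_singleton nth_append min_def)

lemma length_nths_Compl_singleton: "i < length xs \<Longrightarrow> length (nths xs (- {i})) = length xs - 1"
  by (simp add: nths_Compl_singleton)

lemma pairing_det_expand_column:
  assumes "j < length bs"
  shows "pairing_det P as bs =
    (\<Sum>i<length as. (-1) ^ (i + j) * P (as ! i) (bs ! j) * pairing_det P (nths as (- {i})) (nths bs (- {j})))"
proof (cases "length as = length bs")
  case True
  let ?n = "length as"
  let ?A = "mat ?n ?n (\<lambda>(i, j). P (as ! i) (bs ! j))"
  have "mat_delete ?A i j =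
      mat (?n - 1) (?n - 1) (\<lambda>(i', j'). P (nths as (- {i}) ! i') (nths bs (- {j}) ! j'))" if "i < ?n" for i
    unfolding mat_delete_def
    by (rule eq_matI) (use that assms True in \<open>auto simp: nth_nths_Compl_singleton\<close>)
  then have "det (mat_delete ?A i j) = pairing_det P (nths as (- {i})) (nths bs (- {j}))" if "i < ?n" for i
    using that assms True by (simp add: pairing_det_def length_nths_Compl_singleton)
  moreover have "det ?A = (\<Sum>i<?n. ?A $$ (i, j) * cofactor ?A i j)"
    by (rule laplace_expansion_column) (use assms True in auto)
  ultimately show ?thesis
    using assms True by (simp add: pairing_det_def cofactor_def mult_ac)
next
  case False
  \<comment> \<open>Truncated subtraction would only confuse the lengths 0 and 1; both lists are
    nonempty here, so deleting one entry from each keeps the lengths different.\<close>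
  then have "length as - 1 \<noteq> length bs - 1" if "i < length as" for i
    using that assms by linarith
  with False show ?thesis
    using assms by (simp add: pairing_det_def length_nths_Compl_singleton)
qed

text \<open>Each column yields the whole determinant by Laplace expansion, hence the factor. It may
  be written with the number of rows because the determinant is 0 unless the two lengths agree.
  These factors build up the factorial in the powers of the Chern class.\<close>

lemma pairing_det_expand_all:
  "(\<Sum>i<length as. \<Sum>j<length bs. (-1) ^ (i + j) * P (as ! i) (bs ! j) *
      pairing_det P (nths as (- {i})) (nths bs (- {j}))) = of_nat (length as) * pairing_det P as bs"
proof -
  have "(\<Sum>i<length as. \<Sum>j<length bs. (-1) ^ (i + j) * P (as ! i) (bs ! j) *
      pairing_det P (nths as (- {i})) (nths bs (- {j}))) = (\<Sum>j<length bs. pairing_det P as bs)"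
    by (subst sum.swap) (rule sum.cong, use pairing_det_expand_column[of _ bs P as] in auto)
  then show ?thesis
    by (auto simp: pairing_det_def)
qed

lemma pairing_det_swap: "pairing_det P as bs = pairing_det (\<lambda>b a. P a b) bs as"
proof (cases "length as = length bs")
  case True
  let ?A = "mat (length as) (length as) (\<lambda>(i, j). P (as ! i) (bs ! j))"
  have "transpose_mat ?A = mat (length bs) (length bs) (\<lambda>(i, j). P (as ! j) (bs ! i))"
    by (rule eq_matI) (use True in auto)
  then show ?thesis
    using True det_transpose[of ?A "length as"] by (simp add: pairing_det_def)
qed (simp add: pairing_det_def)

lemma pairing_det_map: "pairing_det P as (map h bs) = pairing_det (\<lambda>a b. P a (h b)) as bs"
  unfolding pairing_det_def by (auto intro!: arg_cong[of _ _ det] eq_matI)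

lemma pairing_det_eq_0_left:
  assumes "a \<in> set as" and "\<And>b. b \<in> set bs \<Longrightarrow> P a b = 0"
  shows "pairing_det P as bs = 0"
proof -
  obtain i where i: "i < length as" "a = as ! i"
    using assms(1) by (auto simp: in_set_conv_nth)
  have "pairing_det P as bs = pairing_det (\<lambda>b a. P a b) bs as"
    by (rule pairing_det_swap)
  also have "\<dots> = 0"
    by (subst pairing_det_expand_column[OF i(1)]) (use assms(2) i in auto)
  finally show ?thesis .
qed

text \<open>Splitting off the first functional by \<open>wedge_one_form\<close> is Laplace expansion
  along column 0, so both sides obey the same recursion.\<close>

lemma wedge_list_eq_pairing_det: "wedge_list \<mu>s vs = pairing_det (\<lambda>v \<mu>. of_int (\<mu> v)) vs \<mu>s"
proof (induction \<mu>s arbitrary: vs)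
  case Nil
  show ?case
    by (cases vs) (simp_all add: wedge_list_def unit_form_def pairing_det_Nil, simp add: pairing_det_def)
next
  case (Cons \<mu> \<mu>s)
  have "nths (\<mu> # \<mu>s) (- {0}) = \<mu>s"
    by (simp add: nths_Compl_singleton)
  then show ?case
    using Cons pairing_det_expand_column[of 0 "\<mu> # \<mu>s" "\<lambda>v \<mu>. of_int (\<mu> v)" vs]
    by (simp add: wedge_list_def wedge_one_form)
qed

lemma wedge_list_wrong_length: "length vs \<noteq> length \<mu>s \<Longrightarrow> wedge_list \<mu>s vs = 0"
  by (simp add: wedge_list_eq_pairing_det pairing_det_def)

lemma wedge_list_eq_0_arg:
  assumes "v \<in> set vs" and "\<And>\<mu>. \<mu> \<in> set \<mu>s \<Longrightarrow> \<mu> v = 0"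
  shows "wedge_list \<mu>s vs = 0"
  unfolding wedge_list_eq_pairing_det by (rule pairing_det_eq_0_left[OF assms(1)]) (simp add: assms(2))

lemma wedge_list_zero_factor:
  assumes "(\<lambda>v. 0) \<in> set \<mu>s"
  shows "wedge_list \<mu>s = (\<lambda>vs. 0)"
proof
  fix vs
  show "wedge_list \<mu>s vs = 0"
    unfolding wedge_list_eq_pairing_det
    by (subst pairing_det_swap) (rule pairing_det_eq_0_left[OF assms], simp)
qed

lemma wedge_list_Ints: "wedge_list \<mu>s vs \<in> \<int>"
  by (induction \<mu>s arbitrary: vs)
    (auto simp: wedge_list_def unit_form_def wedge_one_form intro!: Ints_sum Ints_mult)

subsection \<open>The exponential of a class of bidegree one\<close>

text \<open>The basis-free shape of a class in (\<Lambda>^* tensor \<Lambda>) + (N^* tensor N):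
  \<open>P\<close> pairs the outer two slots, \<open>Q\<close> the inner two.\<close>

definition pairing_class ::
  "('a \<Rightarrow> 'd \<Rightarrow> rat) \<Rightarrow> ('b \<Rightarrow> 'c \<Rightarrow> rat) \<Rightarrow> ('a, 'b, 'c, 'd) quadform" where
  "pairing_class P Q = (\<lambda>as bs cs ds.
     (if length as = 1 \<and> bs = [] \<and> cs = [] \<and> length ds = 1 then P (hd as) (hd ds) else 0) +
     (if as = [] \<and> length bs = 1 \<and> length cs = 1 \<and> ds = [] then Q (hd bs) (hd cs) else 0))"

lemma nths_eq_Nil_iff: "S \<subseteq> {..<length xs} \<Longrightarrow> nths xs S = [] \<longleftrightarrow> S = {}"
  by (auto simp: length_nths_subset finite_subset simp flip: length_0_conv)

lemma kprod_add_left: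
  "kprod (\<lambda>as bs cs ds. Z as bs cs ds + Z' as bs cs ds) W as bs cs ds =
    kprod Z W as bs cs ds + kprod Z' W as bs cs ds"
  by (simp add: kprod_def sum.distrib algebra_simps)

lemma nths_UNIV: "nths xs UNIV = xs"
  by (simp add: nths_all)

text \<open>The left factor takes one entry of \<open>as\<close>, one of \<open>ds\<close> and
  nothing else. Its degree on the first torus is 1, so the Koszul sign has as exponent the number of
  entries of \<open>cs\<close> and \<open>ds\<close> left for \<open>W\<close>.\<close>

lemma kprod_outer_pairing:
  "kprod (\<lambda>as bs cs ds. if length as = 1 \<and> bs = [] \<and> cs = [] \<and> length ds = 1 then P (hd as) (hd ds) else 0)
     W as bs cs ds =
   (\<Sum>i<length as. \<Sum>j<length ds. (-1) ^ (i + j) * (-1) ^ (length cs + (length ds - 1)) *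
      P (as ! i) (ds ! j) * W (nths as (- {i})) bs cs (nths ds (- {j})))"
  (is "kprod ?Z W as bs cs ds = _")
proof -
  let ?t = "\<lambda>S T U V. shuffle_sign (length as) S * shuffle_sign (length bs) T *
       shuffle_sign (length cs) U * shuffle_sign (length ds) V *
       (-1) ^ ((length (nths as S) + length (nths bs T)) *
               (length (nths cs (- U)) + length (nths ds (- V)))) *
       ?Z (nths as S) (nths bs T) (nths cs U) (nths ds V) *
       W (nths as (- S)) (nths bs (- T)) (nths cs (- U)) (nths ds (- V))"
  have "kprod ?Z W as bs cs ds = (\<Sum>i<length as. \<Sum>T\<in>Pow {..<length bs}.
     \<Sum>U\<in>Pow {..<length cs}. \<Sum>V\<in>Pow {..<length ds}. ?t {i} T U V)"
    unfolding kprod_def by (rule sum_Pow_singletons) (simp add: length_nths_subset)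
  also have "\<dots> = (\<Sum>i<length as. \<Sum>U\<in>Pow {..<length cs}. \<Sum>V\<in>Pow {..<length ds}. ?t {i} {} U V)"
    by (intro sum.cong refl sum_Pow_empty) (simp add: nths_eq_Nil_iff)
  also have "\<dots> = (\<Sum>i<length as. \<Sum>V\<in>Pow {..<length ds}. ?t {i} {} {} V)"
    by (intro sum.cong refl sum_Pow_empty) (simp add: nths_eq_Nil_iff)
  also have "\<dots> = (\<Sum>i<length as. \<Sum>j<length ds. ?t {i} {} {} {j})"
    by (intro sum.cong refl sum_Pow_singletons) (simp add: length_nths_subset)
  also have "\<dots> = (\<Sum>i<length as. \<Sum>j<length ds. (-1) ^ (i + j) * (-1) ^ (length cs + (length ds - 1)) *
      P (as ! i) (ds ! j) * W (nths as (- {i})) bs cs (nths ds (- {j})))"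
    by (intro sum.cong refl)
      (simp add: nths_singleton_nth shuffle_sign_singleton shuffle_sign_empty nths_UNIV
        length_nths_Compl_singleton power_add)
  finally show ?thesis .
qed

lemma kprod_inner_pairing:
  "kprod (\<lambda>as bs cs ds. if as = [] \<and> length bs = 1 \<and> length cs = 1 \<and> ds = [] then Q (hd bs) (hd cs) else 0)
     W as bs cs ds =
   (\<Sum>i<length bs. \<Sum>j<length cs. (-1) ^ (i + j) * (-1) ^ (length cs - 1 + length ds) *
      Q (bs ! i) (cs ! j) * W as (nths bs (- {i})) (nths cs (- {j})) ds)"
  (is "kprod ?Z W as bs cs ds = _")
proof -
  let ?t = "\<lambda>S T U V. shuffle_sign (length as) S * shuffle_sign (length bs) T *
       shuffle_sign (length cs) U * shuffle_sign (length ds) V *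
       (-1) ^ ((length (nths as S) + length (nths bs T)) *
               (length (nths cs (- U)) + length (nths ds (- V)))) *
       ?Z (nths as S) (nths bs T) (nths cs U) (nths ds V) *
       W (nths as (- S)) (nths bs (- T)) (nths cs (- U)) (nths ds (- V))"
  have "kprod ?Z W as bs cs ds = (\<Sum>T\<in>Pow {..<length bs}.
     \<Sum>U\<in>Pow {..<length cs}. \<Sum>V\<in>Pow {..<length ds}. ?t {} T U V)"
    unfolding kprod_def by (rule sum_Pow_empty) (simp add: nths_eq_Nil_iff)
  also have "\<dots> = (\<Sum>i<length bs. \<Sum>U\<in>Pow {..<length cs}. \<Sum>V\<in>Pow {..<length ds}. ?t {} {i} U V)"
    by (intro sum.cong refl sum_Pow_singletons) (simp add: length_nths_subset)
  also have "\<dots> = (\<Sum>i<length bs. \<Sum>j<length cs. \<Sum>V\<in>Pow {..<length ds}. ?t {} {i} {j} V)"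
    by (intro sum.cong refl sum_Pow_singletons) (simp add: length_nths_subset)
  also have "\<dots> = (\<Sum>i<length bs. \<Sum>j<length cs. ?t {} {i} {j} {})"
    by (intro sum.cong refl sum_Pow_empty) (simp add: nths_eq_Nil_iff)
  also have "\<dots> = (\<Sum>i<length bs. \<Sum>j<length cs. (-1) ^ (i + j) * (-1) ^ (length cs - 1 + length ds) *
      Q (bs ! i) (cs ! j) * W as (nths bs (- {i})) (nths cs (- {j})) ds)"
    by (intro sum.cong refl)
      (simp add: nths_singleton_nth shuffle_sign_singleton shuffle_sign_empty nths_UNIV
        length_nths_Compl_singleton power_add)
  finally show ?thesis .
qed

text \<open>The \<open>k\<close> factors of total degree one on each side are sorted at the cost of the sign
  \<open>(-1)^(k(k-1)/2)\<close>; each of the \<open>k!\<close> orderings contributes the same product of determinants.\<close>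

lemma kpower_pairing_class:
  "kpower (pairing_class P Q) k as bs cs ds =
    (if k = length as + length bs
     then fact k * (-1) ^ (k * (k - 1) div 2) * pairing_det P as ds * pairing_det Q bs cs else 0)"
proof (induction k arbitrary: as bs cs ds)
  case 0
  show ?case
  proof (cases "as = [] \<and> bs = []")
    case True
    then show ?thesis
      by (auto simp: ktens_def unit_class_def tens_def unit_form_def pairing_det_Nil)
        (auto simp: pairing_det_def)
  qed (auto simp: ktens_def unit_class_def tens_def unit_form_def)
next
  case (Suc k)
  let ?s = "fact k * (-1) ^ (k * (k - 1) div 2) :: rat"
  \<comment> \<open>The exponents are triangular numbers: passing from \<open>k\<close> to
    \<open>Suc k\<close> adds \<open>k\<close>, the exponent of the Koszul sign of one further
    factor.\<close>
  have exponent: "(-1 :: rat) ^ (Suc k * (Suc k - 1) div 2) = (-1) ^ k * (-1) ^ (k * (k - 1) div 2)"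
  proof -
    have "Suc k * (Suc k - 1) = k * (k - 1) + 2 * k"
      by (cases k) auto
    then have "Suc k * (Suc k - 1) div 2 = k + k * (k - 1) div 2"
      by simp
    then show ?thesis
      by (simp add: power_add)
  qed
  have outer: "(\<Sum>i<length as. \<Sum>j<length ds. (-1) ^ (i + j) * (-1) ^ (length cs + (length ds - 1)) *
      P (as ! i) (ds ! j) * kpower (pairing_class P Q) k (nths as (- {i})) bs cs (nths ds (- {j})))
    = (if Suc k = length as + length bs
       then ?s * (-1) ^ k * (of_nat (length as) * pairing_det P as ds) * pairing_det Q bs cs else 0)"
    (is "?L = ?R")
  proof -
    have "(-1) ^ (i + j) * (-1) ^ (length cs + (length ds - 1)) *
        P (as ! i) (ds ! j) * kpower (pairing_class P Q) k (nths as (- {i})) bs cs (nths ds (- {j}))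
      = (if Suc k = length as + length bs
         then ?s * (-1) ^ k * pairing_det Q bs cs * ((-1) ^ (i + j) * P (as ! i) (ds ! j) *
           pairing_det P (nths as (- {i})) (nths ds (- {j}))) else 0)"
      if "i < length as" "j < length ds" for i j
    proof (cases "Suc k = length as + length bs \<and> length as = length ds \<and> length bs = length cs")
      case True
      then have "length cs + (length ds - 1) = k"
        using that by linarith
      moreover have "k = length (nths as (- {i})) + length bs"
        using True that unfolding length_nths_Compl_singleton[OF that(1)] by linarith
      ultimately show ?thesis
        using True unfolding Suc.IH by simp
    next
      \<comment> \<open>If the lengths do not match, both sides vanish, by the degree condition on
        the power or by the convention for \<open>pairing_det\<close>.\<close>
      case False
      then have "k \<noteq> length as - 1 + length bs \<or> length as - 1 \<noteq> length ds - 1 \<or> length bs \<noteq> length cs"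
        using that by linarith
      then show ?thesis
        using False that unfolding Suc.IH by (auto simp: pairing_det_def length_nths_Compl_singleton)
    qed
    then have "?L = (\<Sum>i<length as. \<Sum>j<length ds. if Suc k = length as + length bs
         then ?s * (-1) ^ k * pairing_det Q bs cs * ((-1) ^ (i + j) * P (as ! i) (ds ! j) *
           pairing_det P (nths as (- {i})) (nths ds (- {j}))) else 0)"
      by simp
    also have "\<dots> = ?R"
      by (simp add: pairing_det_expand_all flip: sum_distrib_left)
    finally show ?thesis .
  qed
  have inner: "(\<Sum>i<length bs. \<Sum>j<length cs. (-1) ^ (i + j) * (-1) ^ (length cs - 1 + length ds) *
      Q (bs ! i) (cs ! j) * kpower (pairing_class P Q) k as (nths bs (- {i})) (nths cs (- {j})) ds)
    = (if Suc k = length as + length bs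
       then ?s * (-1) ^ k * pairing_det P as ds * (of_nat (length bs) * pairing_det Q bs cs) else 0)"
    (is "?L = ?R")
  proof -
    have "(-1) ^ (i + j) * (-1) ^ (length cs - 1 + length ds) *
        Q (bs ! i) (cs ! j) * kpower (pairing_class P Q) k as (nths bs (- {i})) (nths cs (- {j})) ds
      = (if Suc k = length as + length bs
         then ?s * (-1) ^ k * pairing_det P as ds * ((-1) ^ (i + j) * Q (bs ! i) (cs ! j) *
           pairing_det Q (nths bs (- {i})) (nths cs (- {j}))) else 0)"
      if "i < length bs" "j < length cs" for i j
    proof (cases "Suc k = length as + length bs \<and> length as = length ds \<and> length bs = length cs")
      case True
      then have "length cs - 1 + length ds = k"
        using that by linarith
      moreover have "k = length as + length (nths bs (- {i}))"
        using True that unfolding length_nths_Compl_singleton[OF that(1)] by linarith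
      ultimately show ?thesis
        using True unfolding Suc.IH by simp
    next
      case False
      then have "k \<noteq> length as + (length bs - 1) \<or> length bs - 1 \<noteq> length cs - 1 \<or> length as \<noteq> length ds"
        using that by linarith
      then show ?thesis
        using False that unfolding Suc.IH by (auto simp: pairing_det_def length_nths_Compl_singleton)
    qed
    then have "?L = (\<Sum>i<length bs. \<Sum>j<length cs. if Suc k = length as + length bs
         then ?s * (-1) ^ k * pairing_det P as ds * ((-1) ^ (i + j) * Q (bs ! i) (cs ! j) *
           pairing_det Q (nths bs (- {i})) (nths cs (- {j}))) else 0)"
      by simp
    also have "\<dots> = ?R"
      by (simp add: pairing_det_expand_all flip: sum_distrib_left)
    finally show ?thesis .
  qed
  \<comment> \<open>The outer sum contributes the product of determinants \<open>length as\<close>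
    times and the inner sum \<open>length bs\<close> times, together \<open>Suc k\<close> times;
    this turns \<open>fact k\<close> into \<open>fact (Suc k)\<close>.\<close>
  have "kpower (pairing_class P Q) (Suc k) as bs cs ds = 
    (if Suc k = length as + length bs
     then of_nat (length as + length bs) * (?s * (-1) ^ k * pairing_det P as ds * pairing_det Q bs cs) else 0)"
    unfolding kpower.simps pairing_class_def[of P Q] kprod_add_left kprod_outer_pairing kprod_inner_pairing
    unfolding pairing_class_def[of P Q, symmetric] outer inner
    by (simp add: algebra_simps)
  also have "\<dots> = (if Suc k = length as + length bs
     then of_nat (Suc k) * (?s * (-1) ^ k * pairing_det P as ds * pairing_det Q bs cs) else 0)"
    by (rule if_cong) auto
  finally show ?case
    unfolding exponent fact_Suc by (simp only: mult_ac)
qed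

text \<open>On given arguments only one power contributes, and its factorial cancels. The sign is
  expressed through \<open>cs\<close> and \<open>ds\<close>, which is legitimate because the
  determinants vanish unless the lengths match; in this form it is constant in the vectors and can
  be taken out of the cup product.\<close>

lemma kexp_pairing_class:
  "kexp (pairing_class P Q) as bs cs ds =
    (-1) ^ ((length cs + length ds) * (length cs + length ds - 1) div 2) *
      pairing_det P as ds * pairing_det Q bs cs"
proof -
  let ?k = "length as + length bs"
  have "kexp (pairing_class P Q) as bs cs ds =
      (\<Sum>k\<in>{?k}. 1 / fact k * kpower (pairing_class P Q) k as bs cs ds)"
    unfolding kexp_def by (rule Sum_any.expand_superset) (auto simp: kpower_pairing_class)
  also have "\<dots> = (-1) ^ (?k * (?k - 1) div 2) * pairing_det P as ds * pairing_det Q bs cs"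
    by (simp add: kpower_pairing_class)
  finally show ?thesis
    by (cases "length as = length ds \<and> length bs = length cs") (auto simp: pairing_det_def add.commute)
qed

text \<open>A class pulled back from the first factor has degree 0 in \<open>cs\<close> and
  \<open>ds\<close>. Hence these lists go entirely to \<open>Z\<close>, and the Koszul sign is
  trivial.\<close>

lemma kprod_pullback1:
  "kprod Z (pullback1 x) as bs cs ds = ((\<lambda>as bs. Z as bs cs ds) \<smile> x) as bs"
proof -
  let ?t = "\<lambda>S T U V. shuffle_sign (length as) S * shuffle_sign (length bs) T *
       shuffle_sign (length cs) U * shuffle_sign (length ds) V *
       (-1) ^ ((length (nths as S) + length (nths bs T)) *
               (length (nths cs (- U)) + length (nths ds (- V)))) *
       Z (nths as S) (nths bs T) (nths cs U) (nths ds V) *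
       pullback1 x (nths as (- S)) (nths bs (- T)) (nths cs (- U)) (nths ds (- V))"
  have Compl: "nths xs (- S) = [] \<longleftrightarrow> S = {..<length xs}" if "S \<subseteq> {..<length xs}"
    for S and xs :: "'e list"
  proof -
    have "nths xs (- S) = [] \<longleftrightarrow> {i. i < length xs \<and> i \<in> - S} = {}"
      unfolding length_0_conv[symmetric] length_nths by simp
    with that show ?thesis by auto
  qed
  have Compl_full: "nths xs (- {..<length xs}) = []" for xs :: "'e list"
    by (simp only: Compl order_refl)
  have "kprod Z (pullback1 x) as bs cs ds = (\<Sum>S\<in>Pow {..<length as}. \<Sum>T\<in>Pow {..<length bs}.
      \<Sum>V\<in>Pow {..<length ds}. ?t S T {..<length cs} V)"
    unfolding kprod_def
    by (intro sum.cong refl sum_Pow_full)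
      (simp add: pullback1_def ktens_def unit_class_def tens_def unit_form_def Compl)
  also have "\<dots> = (\<Sum>S\<in>Pow {..<length as}. \<Sum>T\<in>Pow {..<length bs}. ?t S T {..<length cs} {..<length ds})"
    by (intro sum.cong refl sum_Pow_full)
      (simp add: pullback1_def ktens_def unit_class_def tens_def unit_form_def Compl)
  also have "\<dots> = ((\<lambda>as bs. Z as bs cs ds) \<smile> x) as bs"
    unfolding cup_def
    by (intro sum.cong refl)
      (simp add: shuffle_sign_full pullback1_def ktens_def unit_class_def tens_def unit_form_def
        Compl_full del: Compl_lessThan)
  finally show ?thesis .
qed

subsection \<open>Lattices and their duals\<close>

lemma lattice_basis_coords_unique:
  assumes "lattice_basis g b M" and "(\<Sum>i<g. real_of_int (c i) *\<^sub>R b i) = (\<Sum>i<g. real_of_int (c' i) *\<^sub>R b i)"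
    and "i < g"
  shows "c i = c' i"
proof -
  have inj: "inj_on b {..<g}" and ind: "independent (b ` {..<g})"
    using assms(1) by (auto simp: lattice_basis_def)
  \<comment> \<open>Independence speaks of coefficients on the set of basis vectors, so the
    coordinate differences are transported there along the inverse of \<open>b\<close>.\<close>
  let ?u = "\<lambda>v. real_of_int (c (the_inv_into {..<g} b v) - c' (the_inv_into {..<g} b v))"
  have "(\<Sum>v\<in>b ` {..<g}. ?u v *\<^sub>R v) = (\<Sum>i<g. real_of_int (c i - c' i) *\<^sub>R b i)"
    using inj by (simp add: sum.reindex the_inv_into_f_f)
  also have "\<dots> = 0"
    using assms(2) by (simp add: scaleR_left_diff_distrib sum_subtractf)
  finally have "?u (b i) = 0"
    using ind assms(3) by (intro independentD[OF ind, of "b ` {..<g}" ?u]) auto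
  then show ?thesis
    using inj assms(3) by (simp add: the_inv_into_f_f)
qed

lemma lattice_basis_memE:
  assumes "lattice_basis g b M" and "v \<in> M"
  obtains c where "v = (\<Sum>i<g. real_of_int (c i) *\<^sub>R b i)"
  using assms by (auto simp: lattice_basis_def)

lemma lattice_basis_memI:
  assumes "lattice_basis g b M"
  shows "(\<Sum>i<g. real_of_int (c i) *\<^sub>R b i) \<in> M"
  using assms by (auto simp: lattice_basis_def)

lemma lattice_basis_add:
  assumes "lattice_basis g b M" and "v \<in> M" and "w \<in> M"
  shows "v + w \<in> M"
proof -
  obtain c d where "v = (\<Sum>i<g. real_of_int (c i) *\<^sub>R b i)" "w = (\<Sum>i<g. real_of_int (d i) *\<^sub>R b i)"
    using assms by (metis lattice_basis_memE)
  then have "v + w = (\<Sum>i<g. real_of_int (c i + d i) *\<^sub>R b i)"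
    by (simp add: sum.distrib scaleR_left_distrib)
  then show ?thesis
    using lattice_basis_memI[OF assms(1)] by metis
qed

lemma lattice_basis_uminus:
  assumes "lattice_basis g b M" and "v \<in> M"
  shows "- v \<in> M"
proof -
  obtain c where "v = (\<Sum>i<g. real_of_int (c i) *\<^sub>R b i)"
    using assms by (metis lattice_basis_memE)
  then have "- v = (\<Sum>i<g. real_of_int (- c i) *\<^sub>R b i)"
    by (simp add: sum_negf)
  then show ?thesis
    using lattice_basis_memI[OF assms(1)] by metis
qed

lemma lattice_basis_zero: "lattice_basis g b M \<Longrightarrow> 0 \<in> M"
  using lattice_basis_memI[of g b M "\<lambda>i. 0"] by simp

lemma basis_eq_combination:
  fixes b :: "nat \<Rightarrow> 'v::real_vector"
  assumes "i < g"
  shows "b i = (\<Sum>j<g. real_of_int (if i = j then 1 else 0) *\<^sub>R b j)"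
proof -
  have "b i = (\<Sum>j<g. if i = j then b i else 0)"
    using assms by simp
  also have "\<dots> = (\<Sum>j<g. real_of_int (if i = j then 1 else 0) *\<^sub>R b j)"
    by (rule sum.cong) auto
  finally show ?thesis .
qed

lemma lattice_basis_basis:
  assumes "lattice_basis g b M" and "i < g"
  shows "b i \<in> M"
  unfolding basis_eq_combination[OF assms(2), of b] by (rule lattice_basis_memI[OF assms(1)])

section \<open>Integral functionals and dual bases\<close>

lemma dual_add: "f \<in> dual M \<Longrightarrow> v \<in> M \<Longrightarrow> w \<in> M \<Longrightarrow> f (v + w) = f v + f w"
  by (simp add: dual_def)

lemma dual_outside: "f \<in> dual M \<Longrightarrow> v \<notin> M \<Longrightarrow> f v = 0"
  by (simp add: dual_def)

lemma dual_zero: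
  assumes "lattice_basis g b M" and "f \<in> dual M"
  shows "f 0 = 0"
  using dual_add[OF assms(2), of 0 0] lattice_basis_zero[OF assms(1)] by simp

lemma dual_uminus:
  assumes "lattice_basis g b M" and "f \<in> dual M" and "v \<in> M"
  shows "f (- v) = - f v"
  using dual_add[OF assms(2,3) lattice_basis_uminus[OF assms(1,3)]] dual_zero[OF assms(1,2)] by simp

text \<open>Functionals are only known to be additive on \<open>M\<close>, so compatibility with
  integer multiples comes from induction in both directions from 0, with membership in
  \<open>M\<close> carried along.\<close>

lemma dual_scale:
  assumes M: "lattice_basis g b M" and f: "f \<in> dual M" and v: "v \<in> M"
  shows "real_of_int k *\<^sub>R v \<in> M \<and> f (real_of_int k *\<^sub>R v) = k * f v"
proof (induction k rule: int_induct[of _ 0])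
  case base
  show ?case using lattice_basis_zero[OF M] dual_zero[OF M f] by simp
next
  case (step1 k)
  have "real_of_int (k + 1) *\<^sub>R v = real_of_int k *\<^sub>R v + v"
    by (simp add: scaleR_left_distrib)
  then show ?case
    using step1 v lattice_basis_add[OF M] dual_add[OF f] by (simp add: algebra_simps)
next
  case (step2 k)
  have "real_of_int (k - 1) *\<^sub>R v = real_of_int k *\<^sub>R v + - v"
    by (simp add: scaleR_left_diff_distrib)
  then show ?case
    using step2 v lattice_basis_add[OF M _ lattice_basis_uminus[OF M v]] dual_uminus[OF M f v]
      dual_add[OF f _ lattice_basis_uminus[OF M v]]
    by (simp add: algebra_simps)
qed

lemma dual_combination:
  assumes M: "lattice_basis g b M" and f: "f \<in> dual M"
  shows "f (\<Sum>i<g. real_of_int (c i) *\<^sub>R b i) = (\<Sum>i<g. c i * f (b i))"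
proof -
  have "(\<Sum>i<n. real_of_int (c i) *\<^sub>R b i) \<in> M \<and>
      f (\<Sum>i<n. real_of_int (c i) *\<^sub>R b i) = (\<Sum>i<n. c i * f (b i))" if "n \<le> g" for n
    using that
  proof (induction n)
    case 0
    show ?case using lattice_basis_zero[OF M] dual_zero[OF M f] by simp
  next
    case (Suc n)
    then have "b n \<in> M"
      using lattice_basis_basis[OF M] by simp
    then show ?case
      using Suc lattice_basis_add[OF M] dual_scale[OF M f] dual_add[OF f] by simp
  qed
  then show ?thesis by blast
qed

lemma dual_eqI:
  assumes M: "lattice_basis g b M" and "f \<in> dual M" "h \<in> dual M" and "\<And>i. i < g \<Longrightarrow> f (b i) = h (b i)"
  shows "f = h"
proof
  fix v
  show "f v = h v"
  proof (cases "v \<in> M")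
    case True
    then obtain c where "v = (\<Sum>i<g. real_of_int (c i) *\<^sub>R b i)"
      using M by (metis lattice_basis_memE)
    then show ?thesis
      using assms by (simp add: dual_combination[OF M])
  qed (use assms dual_outside in metis)
qed

text \<open>The coordinate function, extended by 0, meets the definite description in
  \<open>dual_basis\<close>; it is the only such functional because functionals are determined on a
  basis.\<close>

lemma dual_basis:
  assumes M: "lattice_basis g b M" and i: "i < g"
  shows dual_basis_in_dual: "dual_basis g b M i \<in> dual M"
    and dual_basis_basis: "j < g \<Longrightarrow> dual_basis g b M i (b j) = (if j = i then 1 else 0)"
proof -
  define coord where "coord v = (SOME c. v = (\<Sum>i<g. real_of_int (c i) *\<^sub>R b i))" for v
  define f where "f v = (if v \<in> M then coord v i else (0::int))" for v
  have coord: "coord (\<Sum>i<g. real_of_int (c i) *\<^sub>R b i) i = c i" for c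
  proof -
    have "(\<Sum>i<g. real_of_int (c i) *\<^sub>R b i) =
        (\<Sum>j<g. real_of_int (coord (\<Sum>i<g. real_of_int (c i) *\<^sub>R b i) j) *\<^sub>R b j)"
      unfolding coord_def[of "\<Sum>i<g. real_of_int (c i) *\<^sub>R b i"] by (rule someI[of _ c]) simp
    then show ?thesis
      by (rule lattice_basis_coords_unique[OF M, symmetric]) (rule i)
  qed
  have f: "f (\<Sum>i<g. real_of_int (c i) *\<^sub>R b i) = c i" for c
    using lattice_basis_memI[OF M] by (simp add: f_def coord)
  have "f \<in> dual M"
  proof -
    have "f (v + w) = f v + f w" if vw: "v \<in> M" "w \<in> M" for v w
    proof -
      obtain c d where cd: "v = (\<Sum>i<g. real_of_int (c i) *\<^sub>R b i)" "w = (\<Sum>i<g. real_of_int (d i) *\<^sub>R b i)"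
        using vw M by (metis lattice_basis_memE)
      then have "v + w = (\<Sum>i<g. real_of_int (c i + d i) *\<^sub>R b i)"
        by (simp add: sum.distrib scaleR_left_distrib)
      then show ?thesis
        using f[of "\<lambda>i. c i + d i"] cd f[of c] f[of d] by simp
    qed
    then show ?thesis
      by (simp add: dual_def f_def)
  qed
  moreover have "f (b j) = (if j = i then 1 else 0)" if "j < g" for j
    unfolding basis_eq_combination[OF that, of b] f by simp
  ultimately have "\<exists>!f. f \<in> dual M \<and> (\<forall>j<g. f (b j) = (if j = i then 1 else 0))"
    using dual_eqI[OF M] by (intro ex1I[of _ f]) auto
  from theI'[OF this] show "dual_basis g b M i \<in> dual M"
    and "j < g \<Longrightarrow> dual_basis g b M i (b j) = (if j = i then 1 else 0)"
    unfolding dual_basis_def by auto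
qed

lemma dual_basis_combination:
  assumes M: "lattice_basis g b M" and i: "i < g"
  shows "dual_basis g b M i (\<Sum>j<g. real_of_int (c j) *\<^sub>R b j) = c i"
proof -
  have "dual_basis g b M i (\<Sum>j<g. real_of_int (c j) *\<^sub>R b j) = (\<Sum>j<g. if j = i then c i else 0)"
    unfolding dual_combination[OF M dual_basis_in_dual[OF M i]]
    by (rule sum.cong) (auto simp: dual_basis_basis[OF M i])
  with i show ?thesis by simp
qed

text \<open>Inside \<open>M\<close> this is the expansion in coordinates; outside both sides are 0
  by the extension convention, so it is an identity of functions.\<close>

lemma dual_expand:
  assumes M: "lattice_basis g b M" and f: "f \<in> dual M"
  shows "f v = (\<Sum>i<g. f (b i) * dual_basis g b M i v)"
proof (cases "v \<in> M")
  case True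
  then obtain c where c: "v = (\<Sum>i<g. real_of_int (c i) *\<^sub>R b i)"
    using M by (metis lattice_basis_memE)
  have "dual_basis g b M i v = c i" if "i < g" for i
    unfolding c by (rule dual_basis_combination[OF M that])
  then show ?thesis
    using dual_combination[OF M f, of c] c by (simp add: mult.commute)
next
  case False
  then have "dual_basis g b M i v = 0" if "i < g" for i
    using dual_outside dual_basis_in_dual[OF M that] by metis
  then show ?thesis
    using dual_outside[OF f False] by simp
qed

lemma dual_separates:
  assumes M: "lattice_basis g b M" and "v \<in> M" "w \<in> M" and eq: "\<And>f. f \<in> dual M \<Longrightarrow> f v = f w"
  shows "v = w"
proof -
  obtain c where c: "v = (\<Sum>i<g. real_of_int (c i) *\<^sub>R b i)"
    using assms by (metis lattice_basis_memE)
  obtain d where d: "w = (\<Sum>i<g. real_of_int (d i) *\<^sub>R b i)"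
    using assms by (metis lattice_basis_memE)
  have "c i = d i" if "i < g" for i
    using eq[OF dual_basis_in_dual[OF M that]] unfolding c d dual_basis_combination[OF M that] .
  then show ?thesis
    unfolding c d by simp
qed

lemma dual_neg: "f \<in> dual M \<Longrightarrow> - f \<in> dual M"
  by (simp add: dual_def)

lemma dual_plus: "f \<in> dual M \<Longrightarrow> h \<in> dual M \<Longrightarrow> f + h \<in> dual M"
  by (simp add: dual_def)

lemma bidual_in_dual: "bidual M v \<in> dual (dual M)"
  by (auto simp: dual_def[of "dual M"] bidual_def dual_plus)

subsection \<open>The Fourier--Mukai transform as a Poincare pairing\<close>

text \<open>By duality of bases the first Chern class does not depend on the bases: it pairs a lattice
  vector with minus a functional. The functional 0 absorbs arguments outside the dual lattice.\<close>

definition dual_negate :: "'v::ab_group_add set \<Rightarrow> ('v \<Rightarrow> int) \<Rightarrow> 'v \<Rightarrow> int" where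
  "dual_negate M \<mu> = (if \<mu> \<in> dual M then - \<mu> else (\<lambda>v. 0))"

lemma dual_negate_expand:
  assumes M: "lattice_basis g b M"
  shows "dual_negate M \<mu> v = - (\<Sum>i<g. dual_basis g b M i v * bidual M (b i) \<mu>)"
  using dual_expand[OF M, of \<mu> v] by (simp add: dual_negate_def bidual_def mult.commute)

lemma c1_poincare_eq_pairing_class:
  assumes N: "lattice_basis g eta N" and L: "lattice_basis g lam \<Lambda>"
  shows "c1_poincare g N \<Lambda> eta lam =
    pairing_class (\<lambda>v \<mu>. of_int (dual_negate \<Lambda> \<mu> v)) (\<lambda>v \<mu>. of_int (dual_negate N \<mu> v))"
proof (intro ext)
  fix as bs :: "'a list" and cs ds :: "('a \<Rightarrow> int) list"
  have sum_app: "(\<Sum>i<g. F i) as bs cs ds = (\<Sum>i<g. F i as bs cs ds)"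
    for F :: "nat \<Rightarrow> ('a, 'a, 'a \<Rightarrow> int, 'a \<Rightarrow> int) quadform"
    by (induction g) auto
  show "c1_poincare g N \<Lambda> eta lam as bs cs ds =
    pairing_class (\<lambda>v \<mu>. of_int (dual_negate \<Lambda> \<mu> v)) (\<lambda>v \<mu>. of_int (dual_negate N \<mu> v)) as bs cs ds"
    unfolding c1_poincare_def pairing_class_def dual_negate_expand[OF N] dual_negate_expand[OF L]
    by (auto simp: sum_app ktens_def tens_def unit_form_def one_form_def)
qed

text \<open>The relevant component of the class has the value -\<mu>(v) = \<mu>(-v), so
  \<open>- v\<close> satisfies the defining condition; it is unique because functionals separate
  lattice points.\<close>

lemma Psi_Lambda_c1_poincare:
  assumes N: "lattice_basis g eta N" and L: "lattice_basis g lam \<Lambda>" and v: "v \<in> \<Lambda>"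
  shows "Psi_Lambda \<Lambda> (c1_poincare g N \<Lambda> eta lam) v = - v"
  unfolding Psi_Lambda_def c1_poincare_eq_pairing_class[OF N L] pairing_class_def
proof (rule the_equality, goal_cases)
  case 1
  then show ?case
    using lattice_basis_uminus[OF L v] dual_uminus[OF L _ v] by (simp add: dual_negate_def)
next
  case (2 u)
  then show ?case
    using lattice_basis_uminus[OF L v] dual_uminus[OF L _ v]
    by (intro dual_separates[OF L]) (auto simp: dual_negate_def simp flip: of_int_minus)
qed

lemma Psi_N_c1_poincare:
  assumes N: "lattice_basis g eta N" and L: "lattice_basis g lam \<Lambda>" and v: "v \<in> N"
  shows "Psi_N N (c1_poincare g N \<Lambda> eta lam) v = - v"
  unfolding Psi_N_def c1_poincare_eq_pairing_class[OF N L] pairing_class_def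
proof (rule the_equality, goal_cases)
  case 1
  then show ?case
    using lattice_basis_uminus[OF N v] dual_uminus[OF N _ v] by (simp add: dual_negate_def)
next
  case (2 u)
  then show ?case
    using lattice_basis_uminus[OF N v] dual_uminus[OF N _ v]
    by (intro dual_separates[OF N]) (auto simp: dual_negate_def simp flip: of_int_minus)
qed

lemma transpose_map_negation:
  assumes M: "lattice_basis g b M" and f: "\<And>v. v \<in> M \<Longrightarrow> f v = - v" and \<mu>: "\<mu> \<in> dual M"
  shows "transpose_map M f \<mu> = dual_negate M \<mu>"
  using dual_uminus[OF M \<mu>] dual_outside[OF \<mu>]
  by (auto simp: fun_eq_iff transpose_map_def dual_negate_def f \<mu>)

lemma cup_scale_left: "(\<lambda>as bs. c * y as bs) \<smile> x = (\<lambda>as bs. c * (y \<smile> x) as bs)"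
  by (simp add: fun_eq_iff cup_def sum_distrib_left mult_ac)

text \<open>With the functionals fixed, the determinants in the exponential are wedge products
  evaluated on the vectors. The functionals in \<open>ds\<close> form the \<Lambda> factor and those
  in \<open>cs\<close> the N factor, which accounts for the interchange of tensor factors in the
  target.\<close>

lemma fourier_mukai_eq_delta_cup:
  assumes N: "lattice_basis g eta N" and L: "lattice_basis g lam \<Lambda>"
  shows "fourier_mukai g N \<Lambda> eta lam x cs ds = delta g N \<Lambda> eta lam (\<lambda>as bs.
    (-1) ^ ((length cs + length ds) * (length cs + length ds - 1) div 2) *
    (wedge_list (map (dual_negate \<Lambda>) ds) \<otimes>\<^sub>f wedge_list (map (dual_negate N) cs) \<smile> x) as bs)"
proof -
  let ?s = "(-1) ^ ((length cs + length ds) * (length cs + length ds - 1) div 2) :: rat"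
  have "(\<lambda>as bs. kexp (c1_poincare g N \<Lambda> eta lam) as bs cs ds) =
    (\<lambda>as bs. ?s * (wedge_list (map (dual_negate \<Lambda>) ds) \<otimes>\<^sub>f wedge_list (map (dual_negate N) cs)) as bs)"
    unfolding c1_poincare_eq_pairing_class[OF N L] kexp_pairing_class tens_def wedge_list_eq_pairing_det
    by (simp add: pairing_det_map mult_ac)
  then show ?thesis
    unfolding fourier_mukai_def pushforward2_def kprod_pullback1 by (simp add: cup_scale_left)
qed

subsection \<open>Poincare duality\<close>

lemma wedge_list_dual_basis_basis:
  assumes M: "lattice_basis g b M"
  shows "wedge_list (map (dual_basis g b M) [0..<g]) (map b [0..<g]) = 1"
proof -
  have "mat g g (\<lambda>(i, j). of_int ((map (dual_basis g b M) [0..<g] ! j) (map b [0..<g] ! i)) :: rat) = 1\<^sub>m g"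
    by (rule eq_matI) (auto simp: dual_basis_basis[OF M])
  then show ?thesis
    by (simp add: wedge_list_eq_pairing_det pairing_det_def)
qed

text \<open>Expanding each functional in the dual basis factors the matrix of pairings, and
  \<open>det\<close> is multiplicative; this is the rank one property of the top exterior
  power.\<close>

lemma wedge_list_top_degree:
  assumes M: "lattice_basis g b M" and "set \<mu>s \<subseteq> dual M" and len: "length \<mu>s = g"
  shows "wedge_list \<mu>s vs =
    wedge_list \<mu>s (map b [0..<g]) * wedge_list (map (dual_basis g b M) [0..<g]) vs"
proof (cases "length vs = g")
  case True
  let ?A = "mat g g (\<lambda>(i, k). of_int (dual_basis g b M k (vs ! i)) :: rat)"
  let ?B = "mat g g (\<lambda>(k, j). of_int ((\<mu>s ! j) (b k)) :: rat)"
  have "mat g g (\<lambda>(i, j). of_int ((\<mu>s ! j) (vs ! i))) = ?A * ?B"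
  proof (rule eq_matI)
    fix i j
    assume "i < dim_row (?A * ?B)" "j < dim_col (?A * ?B)"
    then have ij: "i < g" "j < g" by auto
    then have "\<mu>s ! j \<in> dual M"
      using assms(2) len nth_mem by blast
    from dual_expand[OF M this, of "vs ! i"]
    have "of_int ((\<mu>s ! j) (vs ! i)) = (\<Sum>k<g. of_int (dual_basis g b M k (vs ! i)) * of_int ((\<mu>s ! j) (b k)) :: rat)"
      by (simp add: mult.commute)
    then show "mat g g (\<lambda>(i, j). of_int ((\<mu>s ! j) (vs ! i))) $$ (i, j) = (?A * ?B) $$ (i, j)"
      using ij by (simp add: scalar_prod_def lessThan_atLeast0)
  qed auto
  then have "det (mat g g (\<lambda>(i, j). of_int ((\<mu>s ! j) (vs ! i)) :: rat)) = det ?A * det ?B"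
    by (simp add: det_mult[of _ g])
  moreover have "mat g g (\<lambda>(i, j). of_int ((map (dual_basis g b M) [0..<g] ! j) (vs ! i)) :: rat) = ?A"
    "mat g g (\<lambda>(i, j). of_int ((\<mu>s ! j) (map b [0..<g] ! i)) :: rat) = ?B"
    by (auto intro!: eq_matI)
  ultimately show ?thesis
    using True len by (simp add: wedge_list_eq_pairing_det pairing_det_def mult.commute)
next
  case False
  then show ?thesis
    by (simp add: wedge_list_wrong_length len)
qed

text \<open>The existence half of the definite description in \<open>delta\<close>; without it the
  value of \<open>delta\<close> would be unspecified.\<close>

definition top_multiple ::
  "nat \<Rightarrow> 'v::real_vector set \<Rightarrow> 'v set \<Rightarrow> (nat \<Rightarrow> 'v) \<Rightarrow> (nat \<Rightarrow> 'v) \<Rightarrow> ('v, 'v) biform \<Rightarrow> bool" where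
  "top_multiple g N \<Lambda> eta lam y \<longleftrightarrow>
     (\<exists>c. bideg_proj g g y = (\<lambda>as bs. c * top_class g N \<Lambda> eta lam as bs))"

text \<open>The top class takes the value 1 on the two bases, so evaluating there recovers the
  coefficient and shows its uniqueness.\<close>

lemma delta_eq_eval:
  assumes N: "lattice_basis g eta N" and L: "lattice_basis g lam \<Lambda>"
    and "top_multiple g N \<Lambda> eta lam y"
  shows "delta g N \<Lambda> eta lam y = y (map lam [0..<g]) (map eta [0..<g])"
proof -
  obtain c where c: "bideg_proj g g y = (\<lambda>as bs. c * top_class g N \<Lambda> eta lam as bs)"
    using assms(3) by (auto simp: top_multiple_def)
  have top: "top_class g N \<Lambda> eta lam (map lam [0..<g]) (map eta [0..<g]) = 1"
    by (simp add: top_class_def tens_def wedge_list_dual_basis_basis[OF N] wedge_list_dual_basis_basis[OF L])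
  have coeff: "d = y (map lam [0..<g]) (map eta [0..<g])"
    if "bideg_proj g g y = (\<lambda>as bs. d * top_class g N \<Lambda> eta lam as bs)" for d
    using fun_cong[OF fun_cong[OF that], of "map lam [0..<g]" "map eta [0..<g]"] top
    by (simp add: bideg_proj_def)
  show ?thesis
    unfolding delta_def
  proof (rule the_equality)
    show "bideg_proj g g y =
        (\<lambda>as bs. y (map lam [0..<g]) (map eta [0..<g]) * top_class g N \<Lambda> eta lam as bs)"
      using c coeff[OF c] by simp
  qed (rule coeff)
qed

lemma top_multiple_zero: "top_multiple g N \<Lambda> eta lam (\<lambda>as bs. 0)"
  unfolding top_multiple_def by (rule exI[of _ 0]) (auto simp: bideg_proj_def)

lemma top_multiple_scale:
  assumes "top_multiple g N \<Lambda> eta lam y"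
  shows "top_multiple g N \<Lambda> eta lam (\<lambda>as bs. c * y as bs)"
proof -
  obtain d where d: "bideg_proj g g y = (\<lambda>as bs. d * top_class g N \<Lambda> eta lam as bs)"
    using assms by (auto simp: top_multiple_def)
  have "bideg_proj g g (\<lambda>as bs. c * y as bs) = (\<lambda>as bs. c * bideg_proj g g y as bs)"
    by (auto simp: bideg_proj_def fun_eq_iff)
  then show ?thesis
    unfolding top_multiple_def d by (intro exI[of _ "c * d"]) (simp add: mult.assoc)
qed

lemma top_multiple_diff:
  assumes "top_multiple g N \<Lambda> eta lam y" and "top_multiple g N \<Lambda> eta lam y'"
  shows "top_multiple g N \<Lambda> eta lam (y - y')"
proof -
  obtain c where c: "bideg_proj g g y = (\<lambda>as bs. c * top_class g N \<Lambda> eta lam as bs)"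
    using assms by (auto simp: top_multiple_def)
  obtain d where d: "bideg_proj g g y' = (\<lambda>as bs. d * top_class g N \<Lambda> eta lam as bs)"
    using assms by (auto simp: top_multiple_def)
  have "bideg_proj g g (y - y') = (\<lambda>as bs. bideg_proj g g y as bs - bideg_proj g g y' as bs)"
    by (auto simp: bideg_proj_def fun_eq_iff)
  then show ?thesis
    unfolding top_multiple_def c d by (intro exI[of _ "c - d"]) (simp add: left_diff_distrib)
qed

lemma top_multiple_wedge_list:
  assumes N: "lattice_basis g eta N" and L: "lattice_basis g lam \<Lambda>"
    and "set \<mu>s \<subseteq> dual \<Lambda>" and "set \<nu>s \<subseteq> dual N"
  shows "top_multiple g N \<Lambda> eta lam (wedge_list \<mu>s \<otimes>\<^sub>f wedge_list \<nu>s)"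
proof (cases "length \<mu>s = g \<and> length \<nu>s = g")
  case True
  let ?c = "wedge_list \<mu>s (map lam [0..<g]) * wedge_list \<nu>s (map eta [0..<g])"
  have "bideg_proj g g (wedge_list \<mu>s \<otimes>\<^sub>f wedge_list \<nu>s) as bs = ?c * top_class g N \<Lambda> eta lam as bs" for as bs
    using wedge_list_top_degree[OF L assms(3), of as] wedge_list_top_degree[OF N assms(4), of bs] True
    by (auto simp: bideg_proj_def tens_def top_class_def wedge_list_wrong_length)
  then show ?thesis
    unfolding top_multiple_def by blast
next
  case False
  then have "bideg_proj g g (wedge_list \<mu>s \<otimes>\<^sub>f wedge_list \<nu>s) = (\<lambda>as bs. 0 * top_class g N \<Lambda> eta lam as bs)"
    by (auto simp: bideg_proj_def tens_def fun_eq_iff wedge_list_wrong_length)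
  then show ?thesis
    unfolding top_multiple_def by blast
qed

section \<open>The group of integral tensors and its cup products\<close>

lemma cup_diff_right: "y \<smile> (x - x') = (y \<smile> x) - (y \<smile> x')"
  by (simp add: fun_eq_iff cup_def sum_subtractf algebra_simps)

lemma cup_zero_right: "y \<smile> (\<lambda>as bs. 0) = (\<lambda>as bs. 0)"
  by (simp add: cup_def)

lemma cup_zero_left: "(\<lambda>as bs. 0) \<smile> x = (\<lambda>as bs. 0)"
  by (simp add: cup_def)

lemma ext_tensor_induct [consumes 1, case_names zero gen diff]:
  assumes "z \<in> ext_tensor A B q p"
    and "P (\<lambda>as bs. 0)"
    and "\<And>\<mu>s \<nu>s. \<lbrakk>set \<mu>s \<subseteq> dual A; length \<mu>s = q; set \<nu>s \<subseteq> dual B; length \<nu>s = p\<rbrakk>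
      \<Longrightarrow> P (wedge_list \<mu>s \<otimes>\<^sub>f wedge_list \<nu>s)"
    and "\<And>x y. \<lbrakk>P x; P y\<rbrakk> \<Longrightarrow> P (x - y)"
  shows "P z"
  using assms(1) unfolding ext_tensor_def
proof (induction rule: group_closure.induct)
  case (base s)
  then show ?case
    using assms(2,3) by (auto simp: zero_fun_def in_lists_conv_set subset_iff)
qed (rule assms(4))

lemma ext_tensor_wedge_list:
  "\<lbrakk>set \<mu>s \<subseteq> dual A; length \<mu>s = q; set \<nu>s \<subseteq> dual B; length \<nu>s = p\<rbrakk>
    \<Longrightarrow> wedge_list \<mu>s \<otimes>\<^sub>f wedge_list \<nu>s \<in> ext_tensor A B q p"
  unfolding ext_tensor_def by (rule group_closure.base, rule insertI2) (auto simp: lists_eq_set)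

lemma ext_tensor_zero: "(\<lambda>as bs. 0) \<in> ext_tensor A B q p"
proof -
  have "(\<lambda>as bs. 0) = (0 :: ('a, 'b) biform)"
    by (simp add: fun_eq_iff)
  then show ?thesis
    unfolding ext_tensor_def by (simp only: zero_in_group_closure)
qed

lemma ext_tensor_add: "\<lbrakk>z \<in> ext_tensor A B q p; w \<in> ext_tensor A B q p\<rbrakk> \<Longrightarrow> z + w \<in> ext_tensor A B q p"
  unfolding ext_tensor_def by (rule group_closure_add)

lemma ext_tensor_sum:
  "(\<And>i. i \<in> I \<Longrightarrow> z i \<in> ext_tensor A B q p) \<Longrightarrow> (\<lambda>as bs. \<Sum>i\<in>I. z i as bs) \<in> ext_tensor A B q p"
proof (induction I rule: infinite_finite_induct)
  case (insert i I)
  then have "z i + (\<lambda>as bs. \<Sum>i\<in>I. z i as bs) \<in> ext_tensor A B q p"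
    by (intro ext_tensor_add) auto
  with insert show ?case
    by (simp add: plus_fun_def)
qed (simp_all add: ext_tensor_zero)

lemma ext_tensor_scale:
  assumes "z \<in> ext_tensor A B q p" and "c \<in> \<int>"
  shows "(\<lambda>as bs. c * z as bs) \<in> ext_tensor A B q p"
proof -
  obtain k where k: "c = of_int k"
    using assms(2) by (auto elim: Ints_cases)
  have nat: "(\<lambda>as bs. of_nat n * z as bs) \<in> ext_tensor A B q p" for n
  proof (induction n)
    case (Suc n)
    from ext_tensor_add[OF assms(1) this] show ?case
      by (simp add: plus_fun_def algebra_simps)
  qed (simp add: ext_tensor_zero)
  show ?thesis
  proof (cases "k \<ge> 0")
    case True
    with nat[of "nat k"] k show ?thesis
      by simp
  next
    case False
    from nat[of "nat (- k)"] have "- (\<lambda>as bs. of_nat (nat (- k)) * z as bs) \<in> ext_tensor A B q p"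
      unfolding ext_tensor_def by simp
    with False k show ?thesis
      by (simp add: fun_Compl_def)
  qed
qed

text \<open>Vanishing off lists of the right lengths with entries in the lattices makes an element
  determined by its values on such lists, as the uniqueness of the Poincare dual requires.\<close>

lemma ext_tensor_support:
  assumes "z \<in> ext_tensor A B q p"
    and "\<not> (set as \<subseteq> A \<and> length as = q \<and> set bs \<subseteq> B \<and> length bs = p)"
  shows "z as bs = 0"
  using assms(1)
proof (induction rule: ext_tensor_induct)
  case (gen \<mu>s \<nu>s)
  consider "length as \<noteq> q" | "length bs \<noteq> p" | v where "v \<in> set as" "v \<notin> A" | v where "v \<in> set bs" "v \<notin> B"
    using assms(2) by auto
  then show ?case
  proof cases
    case 3
    have "wedge_list \<mu>s as = 0"
      by (rule wedge_list_eq_0_arg[OF 3(1)]) (use gen 3(2) dual_outside in blast)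
    then show ?thesis by (simp add: tens_def)
  next
    case 4
    have "wedge_list \<nu>s bs = 0"
      by (rule wedge_list_eq_0_arg[OF 4(1)]) (use gen 4(2) dual_outside in blast)
    then show ?thesis by (simp add: tens_def)
  qed (use gen in \<open>auto simp: tens_def wedge_list_wrong_length\<close>)
qed auto

text \<open>The coefficients of the Poincare dual are, up to sign, values of the class; being
  integers, they act on the group generated by the pure tensors.\<close>

lemma ext_tensor_Ints:
  assumes "z \<in> ext_tensor A B q p"
  shows "z as bs \<in> \<int>"
  using assms by (induction rule: ext_tensor_induct) (auto simp: tens_def wedge_list_Ints)

text \<open>For a generator the cup product is again a tensor of wedge products of functionals, and
  multiples of the top class are closed under differences. Hence \<open>delta\<close> of such a
  product is an evaluation on the bases.\<close>

lemma top_multiple_cup: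
  assumes N: "lattice_basis g eta N" and L: "lattice_basis g lam \<Lambda>"
    and x: "x \<in> ext_tensor \<Lambda> N q p" and \<mu>s: "set \<mu>s \<subseteq> dual \<Lambda>" and \<nu>s: "set \<nu>s \<subseteq> dual N"
  shows "top_multiple g N \<Lambda> eta lam (wedge_list \<mu>s \<otimes>\<^sub>f wedge_list \<nu>s \<smile> x)"
  using x
proof (induction rule: ext_tensor_induct)
  case zero
  show ?case
    by (simp add: cup_zero_right top_multiple_zero)
next
  case (gen \<mu>s' \<nu>s')
  then show ?case
    unfolding cup_tens wedge_list_append[symmetric]
    using \<mu>s \<nu>s by (intro top_multiple_wedge_list[OF N L]) auto
next
  case (diff x y)
  then show ?case
    unfolding cup_diff_right by (rule top_multiple_diff)
qed

text \<open>A nonzero value requires a nonzero shuffle term, and in such a term each factor receives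
  as many arguments as its degree.\<close>

lemma cup_eval_degree:
  assumes x: "x \<in> ext_tensor \<Lambda> N q p"
    and "(wedge_list \<mu>s \<otimes>\<^sub>f wedge_list \<nu>s \<smile> x) as bs \<noteq> 0"
  shows "length as = length \<mu>s + q" and "length bs = length \<nu>s + p"
proof -
  obtain S T where ST: "S \<subseteq> {..<length as}" "T \<subseteq> {..<length bs}"
    and nz: "shuffle_sign (length as) S * shuffle_sign (length bs) T *
      (wedge_list \<mu>s \<otimes>\<^sub>f wedge_list \<nu>s) (nths as S) (nths bs T) * x (nths as (- S)) (nths bs (- T)) \<noteq> 0"
    using assms(2) unfolding cup_def by (meson PowD sum.not_neutral_contains_not_neutral)
  have "length (nths as (- S)) = q" "length (nths bs (- T)) = p"
    using nz ext_tensor_support[OF x] by auto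
  moreover have "length (nths as S) = length \<mu>s" "length (nths bs T) = length \<nu>s"
    using nz wedge_list_wrong_length[of "nths as S" \<mu>s] wedge_list_wrong_length[of "nths bs T" \<nu>s]
    by (auto simp: tens_def)
  moreover have "card S \<le> length as" "card T \<le> length bs"
    using ST card_mono[of "{..<length as}" S] card_mono[of "{..<length bs}" T] by auto
  ultimately show "length as = length \<mu>s + q" "length bs = length \<nu>s + p"
    using ST by (auto simp: length_nths_subset length_nths_Compl)
qed

text \<open>Since \<open>(\<mu>\<^sub>1 \<and> \<dots> \<and> \<mu>\<^sub>k)(v\<^sub>1, \<dots>, v\<^sub>k) = (v\<^sub>1 \<and> \<dots> \<and> v\<^sub>k)(\<mu>\<^sub>1, \<dots>, \<mu>\<^sub>k)\<close>, expanding the cup product on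
  the bases of the lattices already displays the dual functional as an integral element.\<close>

lemma wedge_list_bidual:
  assumes "set \<mu>s \<subseteq> dual M"
  shows "wedge_list (map (bidual M) vs) \<mu>s = wedge_list \<mu>s vs"
proof -
  have "wedge_list (map (bidual M) vs) \<mu>s = pairing_det (\<lambda>\<mu> v. of_int (bidual M v \<mu>)) \<mu>s vs"
    unfolding wedge_list_eq_pairing_det pairing_det_map ..
  also have "\<dots> = pairing_det (\<lambda>\<mu> v. of_int (\<mu> v)) \<mu>s vs"
    using assms unfolding pairing_det_def
    by (auto intro!: arg_cong[of _ _ det] eq_matI simp: bidual_def subset_iff)
  also have "\<dots> = wedge_list \<mu>s vs"
    unfolding wedge_list_eq_pairing_det by (rule pairing_det_swap)
  finally show ?thesis .
qed

lemma poincare_duality_eq_eval: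
  assumes N: "lattice_basis g eta N" and L: "lattice_basis g lam \<Lambda>"
    and x: "x \<in> ext_tensor \<Lambda> N q p" and \<mu>s: "set \<mu>s \<subseteq> dual \<Lambda>" and \<nu>s: "set \<nu>s \<subseteq> dual N"
  shows "poincare_duality g N \<Lambda> eta lam p q x \<mu>s \<nu>s =
    (wedge_list \<mu>s \<otimes>\<^sub>f wedge_list \<nu>s \<smile> x) (map lam [0..<g]) (map eta [0..<g])"
proof -
  let ?l = "map lam [0..<g]" and ?e = "map eta [0..<g]"
  define coeff where "coeff S T = shuffle_sign g S * shuffle_sign g T * x (nths ?l (- S)) (nths ?e (- T))" for S T
  define z where "z = (\<lambda>\<mu>s \<nu>s. \<Sum>S\<in>Pow {..<g}. \<Sum>T\<in>Pow {..<g}. coeff S T *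
    (wedge_list (map (bidual \<Lambda>) (nths ?l S)) \<otimes>\<^sub>f wedge_list (map (bidual N) (nths ?e T))) \<mu>s \<nu>s)"
  have z_mem: "z \<in> ext_tensor (dual \<Lambda>) (dual N) (g - q) (g - p)"
    unfolding z_def
  proof (intro ext_tensor_sum)
    fix S T
    assume S: "S \<in> Pow {..<g}" and T: "T \<in> Pow {..<g}"
    let ?w = "wedge_list (map (bidual \<Lambda>) (nths ?l S)) \<otimes>\<^sub>f wedge_list (map (bidual N) (nths ?e T))"
    have card: "card S \<le> g" "card T \<le> g"
      using S T card_mono[of "{..<g}" S] card_mono[of "{..<g}" T] by auto
    show "(\<lambda>\<mu>s \<nu>s. coeff S T * ?w \<mu>s \<nu>s) \<in> ext_tensor (dual \<Lambda>) (dual N) (g - q) (g - p)"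
    proof (cases "length (nths ?l (- S)) = q \<and> length (nths ?e (- T)) = p")
      case True
      then have "card S = g - q" "card T = g - p"
        using S T card by (auto simp: length_nths_Compl)
      then have "?w \<in> ext_tensor (dual \<Lambda>) (dual N) (g - q) (g - p)"
        using S T by (intro ext_tensor_wedge_list) (auto simp: bidual_in_dual length_nths_subset)
      then show ?thesis
        by (rule ext_tensor_scale)
          (auto simp: coeff_def shuffle_sign_def ext_tensor_Ints[OF x] intro!: Ints_mult Ints_power)
    next
      \<comment> \<open>Here the complements have the wrong sizes for the homogeneous class
        \<open>x\<close>, so the term is 0 and lies in the group trivially.\<close>
      case False
      then have "coeff S T = 0"
        using ext_tensor_support[OF x, of "nths ?l (- S)" "nths ?e (- T)"] by (auto simp: coeff_def)
      then show ?thesis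
        by (simp add: ext_tensor_zero)
    qed
  qed
  have z_eval: "z \<mu>s \<nu>s = (wedge_list \<mu>s \<otimes>\<^sub>f wedge_list \<nu>s \<smile> x) ?l ?e"
    if "set \<mu>s \<subseteq> dual \<Lambda>" "set \<nu>s \<subseteq> dual N" for \<mu>s \<nu>s
    unfolding z_def cup_def using that
    by (intro sum.cong) (auto simp: coeff_def tens_def wedge_list_bidual mult_ac)
  have "poincare_duality g N \<Lambda> eta lam p q x = z"
    unfolding poincare_duality_def element_of_functional_def
  proof (rule the_equality, goal_cases)
    case 1
    show ?case
      using z_mem z_eval delta_eq_eval[OF N L top_multiple_cup[OF N L x]]
      by (auto simp: in_lists_conv_set subset_iff)
  next
    case (2 w)
    show ?case
    proof (intro ext)
      fix \<mu>s \<nu>s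
      show "w \<mu>s \<nu>s = z \<mu>s \<nu>s"
      proof (cases "set \<mu>s \<subseteq> dual \<Lambda> \<and> length \<mu>s = g - q \<and> set \<nu>s \<subseteq> dual N \<and> length \<nu>s = g - p")
        case True
        then have "w \<mu>s \<nu>s = delta g N \<Lambda> eta lam (wedge_list \<mu>s \<otimes>\<^sub>f wedge_list \<nu>s \<smile> x)"
          using 2 by (auto simp: in_lists_conv_set subset_iff)
        then show ?thesis
          using True z_eval delta_eq_eval[OF N L top_multiple_cup[OF N L x]] by simp
      next
        \<comment> \<open>Off the prescribed lists both candidates vanish by their support, so the
          pairing condition fixes the element as a function on all lists.\<close>
        case False
        then show ?thesis
          using ext_tensor_support[OF z_mem False] ext_tensor_support[OF conjunct1[OF 2] False] by simp
      qed
    qed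
  qed
  then show ?thesis
    using z_eval[OF \<mu>s \<nu>s] by simp
qed

section \<open>Comparison of the transform with the duality map\<close>

lemma dual_negate_in_dual: "\<mu> \<in> dual M \<Longrightarrow> dual_negate M \<mu> \<in> dual M"
  by (simp add: dual_negate_def dual_neg)

lemma wedge_list_dual_negate_outside:
  assumes "\<not> set \<mu>s \<subseteq> dual M"
  shows "wedge_list (map (dual_negate M) \<mu>s) = (\<lambda>vs. 0)"
  by (rule wedge_list_zero_factor) (use assms in \<open>auto simp: dual_negate_def image_iff\<close>)

theorem proposition5p4:
  fixes g p q :: nat
    and N \<Lambda> :: "'v::real_vector set"
    and eta lam :: "nat \<Rightarrow> 'v"
    and x :: "('v, 'v) biform"
  assumes "real_torus g N \<Lambda>"
    and "lattice_basis g eta N"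
    and "lattice_basis g lam \<Lambda>"
    and "same_orientation g eta lam"
    and "x \<in> trop_coh N \<Lambda> p q"
  shows "fourier_mukai g N \<Lambda> eta lam x =
    (\<lambda>cs ds.
      (-1) ^ nat ((2 * int g - (int p + int q)) * (2 * int g - (int p + int q) - 1) div 2)
      * alpha_map g N \<Lambda> eta lam p q x cs ds)"
proof (intro ext)
  fix cs ds :: "('v \<Rightarrow> int) list"
  note N = assms(2) and L = assms(3)
  have x: "x \<in> ext_tensor \<Lambda> N q p"
    using assms(5) by (simp add: trop_coh_def)
  let ?s = "(-1) ^ nat ((2 * int g - (int p + int q)) * (2 * int g - (int p + int q) - 1) div 2) :: rat"
  let ?ds = "map (dual_negate \<Lambda>) ds" and ?cs = "map (dual_negate N) cs"
  let ?y = "wedge_list ?ds \<otimes>\<^sub>f wedge_list ?cs \<smile> x"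
  let ?m = "length cs + length ds"
  show "fourier_mukai g N \<Lambda> eta lam x cs ds = ?s * alpha_map g N \<Lambda> eta lam p q x cs ds"
  proof (cases "set ds \<subseteq> dual \<Lambda> \<and> set cs \<subseteq> dual N")
    case True
    then have mem: "set ?ds \<subseteq> dual \<Lambda>" "set ?cs \<subseteq> dual N"
      by (auto simp: dual_negate_in_dual)
    have top: "top_multiple g N \<Lambda> eta lam ?y"
      using top_multiple_cup[OF N L x mem] .
    have transpose: "map (transpose_map \<Lambda> (Psi_Lambda \<Lambda> (c1_poincare g N \<Lambda> eta lam))) ds = ?ds"
      "map (transpose_map N (Psi_N N (c1_poincare g N \<Lambda> eta lam))) cs = ?cs"
      using True transpose_map_negation[OF L Psi_Lambda_c1_poincare[OF N L]]
        transpose_map_negation[OF N Psi_N_c1_poincare[OF N L]] by auto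
    have "ds \<in> lists (dual \<Lambda>) \<and> cs \<in> lists (dual N)"
      using True by (auto simp: lists_eq_set)
    then have alpha: "alpha_map g N \<Lambda> eta lam p q x cs ds = ?y (map lam [0..<g]) (map eta [0..<g])"
      unfolding alpha_map_def swap_factors_def induced_map_def transpose
      using poincare_duality_eq_eval[OF N L x mem] by simp
    have fm: "fourier_mukai g N \<Lambda> eta lam x cs ds =
        (-1) ^ (?m * (?m - 1) div 2) * ?y (map lam [0..<g]) (map eta [0..<g])"
      unfolding fourier_mukai_eq_delta_cup[OF N L] by (rule delta_eq_eval[OF N L top_multiple_scale[OF top]])
    show ?thesis
    proof (cases "?y (map lam [0..<g]) (map eta [0..<g]) = 0")
      case True
      then show ?thesis by (simp add: fm alpha)
    next
      case False
      \<comment> \<open>The kernel produces a sign depending on the number \<open>?m\<close> of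
        arguments. It has to match the prescribed sign only where the common value is nonzero, and
        there the degrees force \<open>?m\<close> to be 2g - (p + q).\<close>
      from cup_eval_degree[OF x this] have "2 * int g - (int p + int q) = int ?m"
        by simp
      \<comment> \<open>For \<open>?m = 0\<close> the truncated predecessor differs from the integer
        -1, but the factor 0 makes the products agree.\<close>
      moreover have "int ?m * (int ?m - 1) = int (?m * (?m - 1))"
        by (cases ?m) (auto simp: algebra_simps)
      then have "nat (int ?m * (int ?m - 1) div 2) = ?m * (?m - 1) div 2"
        by (metis nat_int of_nat_numeral zdiv_int)
      ultimately show ?thesis
        by (simp only: fm alpha)
    qed
  next
    case False
    \<comment> \<open>\<open>dual_negate\<close> sends a functional outside its dual lattice to 0
      and thereby kills a wedge factor, while \<open>induced_map\<close> is 0 on such arguments by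
      definition.\<close>
    then have "wedge_list ?ds \<otimes>\<^sub>f wedge_list ?cs = (\<lambda>as bs. 0)"
      using wedge_list_dual_negate_outside by (auto simp: tens_def fun_eq_iff)
    then have "?y = (\<lambda>as bs. 0)"
      by (simp add: cup_zero_left)
    then have "fourier_mukai g N \<Lambda> eta lam x cs ds = 0"
      using delta_eq_eval[OF N L top_multiple_zero] unfolding fourier_mukai_eq_delta_cup[OF N L] by simp
    moreover have "alpha_map g N \<Lambda> eta lam p q x cs ds = 0"
      using False by (auto simp: alpha_map_def swap_factors_def induced_map_def in_lists_conv_set)
    ultimately show ?thesis
      by simp
  qed
qed

end
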